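(* Let $M=(m_1,\dots,m_q,n)$, $q\ge1$, be a semidominant ideal, where $\{m_1,\dots,m_q,n\}$ is the minimal generating set, $m_1,\dots,m_q$ are dominant and $n$ is nondominant. Then $\operatorname{pd}(S/M)=2$ if and only if $n\mid\operatorname{lcm}(m_i,m_j)$ for all $i\neq j$.
   Context: $S$ is a polynomial ring in finitely many variables over an arbitrary field; $\operatorname{pd}$ denotes projective dimension over $S$. Given a set $G$ of monomials, $m\in G$ is dominant (with respect to $G$) if there are a variable $x$ and an integer $k\ge1$ with $x^k\mid m$ and $x^k\nmid m'$ for all $m'\in G\setminus\{m\}$. A set of monomials is semidominant if exactly one of its elements is not dominant; a monomial ideal is semidominant if its minimal generating set is semidominant. *)

theory Defs
  imports
    "HOL-Algebra.Algebraic_Closure_Type"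
    "HOL-Algebra.QuotRing"
    "HOL-Algebra.Module"
    "HOL-Library.Poly_Mapping"
    "HOL-Library.Extended_Nat"
begin

section \<open>Modules and projective dimension\<close>

definition mod_hom ::
  "('a, 'r) ring_scheme \<Rightarrow> ('a, 'b, 'm) module_scheme \<Rightarrow> ('a, 'c, 'n) module_scheme \<Rightarrow> ('b \<Rightarrow> 'c) set"
  where "mod_hom R A B = {h. h \<in> carrier A \<rightarrow> carrier B \<and>
    (\<forall>x\<in>carrier A. \<forall>y\<in>carrier A. h (x \<oplus>\<^bsub>A\<^esub> y) = h x \<oplus>\<^bsub>B\<^esub> h y) \<and>
    (\<forall>r\<in>carrier R. \<forall>x\<in>carrier A. h (r \<odot>\<^bsub>A\<^esub> x) = r \<odot>\<^bsub>B\<^esub> h x)}"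

text \<open>
  The lifting property against surjections \<open>g : A \<rightarrow> B\<close>. A definition cannot quantify over the
  carrier types of \<open>A\<close> and \<open>B\<close>; the two types chosen here suffice, since they contain the canonical
  surjection of the free module on the set \<open>P\<close> onto \<open>P\<close>. Lifting against modules of arbitrary
  types follows: see \<open>projective_module_lift\<close> below.
\<close>
definition projective_module :: "('a, 'r) ring_scheme \<Rightarrow> ('a, 'u) module \<Rightarrow> bool"
  where "projective_module R P \<longleftrightarrow> module R P \<and>
    (\<forall>(A :: ('a, 'u \<Rightarrow> 'a) module) (B :: ('a, 'u) module).
      \<forall>g\<in>mod_hom R A B. \<forall>f\<in>mod_hom R P B.
        module R A \<longrightarrow> module R B \<longrightarrow> g ` carrier A = carrier B \<longrightarrow>
          (\<exists>h\<in>mod_hom R P A. \<forall>x\<in>carrier P. g (h x) = f x))"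

text \<open>
  An exact complex \<open>\<dots> \<rightarrow> P 2 \<rightarrow> P 1 \<rightarrow> P 0 \<rightarrow> N \<rightarrow> 0\<close> with all \<open>P i\<close> projective, where
  \<open>\<delta> i : P (i + 1) \<rightarrow> P i\<close> and \<open>\<epsilon> : P 0 \<rightarrow> N\<close>.
\<close>
definition projective_resolution ::
  "('a, 'r) ring_scheme \<Rightarrow> ('a, 'b) module \<Rightarrow>
    (nat \<Rightarrow> ('a, 'u) module) \<Rightarrow> (nat \<Rightarrow> 'u \<Rightarrow> 'u) \<Rightarrow> ('u \<Rightarrow> 'b) \<Rightarrow> bool"
  where "projective_resolution R N P \<delta> \<epsilon> \<longleftrightarrow>
    (\<forall>i. projective_module R (P i)) \<and>
    \<epsilon> \<in> mod_hom R (P 0) N \<and>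
    (\<forall>i. \<delta> i \<in> mod_hom R (P (Suc i)) (P i)) \<and>
    \<epsilon> ` carrier (P 0) = carrier N \<and>
    \<delta> 0 ` carrier (P 1) = a_kernel (P 0) N \<epsilon> \<and>
    (\<forall>i. \<delta> (Suc i) ` carrier (P (Suc (Suc i))) = a_kernel (P (Suc i)) (P i) (\<delta> i))"

text \<open>
  The minimal length of a projective resolution (\<open>\<infinity>\<close> if there is no finite one; with this
  convention the zero module has dimension \<open>0\<close>).
  The terms of the resolutions are taken with carriers in \<open>nat \<times> 'b \<Rightarrow> 'a\<close>, for \<open>R\<close> over \<open>'a\<close> and
  \<open>N\<close> over \<open>'b\<close>. For \<open>R\<close> nontrivial this is no restriction: the finitely supported functions
  in this type already number \<open>\<kappa> = max(\<aleph>\<^sub>0, |'a|, |'b|)\<close>, and in the free resolution of \<open>N\<close> which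
  takes all elements of the previous kernel as generators no term has more than \<open>\<kappa>\<close> elements.
  So that resolution can be transported into this type, and by Schanuel's lemma, if \<open>N\<close> has a
  projective resolution of length \<open>d\<close> over any types, then cutting it off at its \<open>d\<close>-th syzygy
  gives one of length at most \<open>d\<close> in this type.
\<close>
definition proj_dim :: "('a, 'r) ring_scheme \<Rightarrow> ('a, 'b) module \<Rightarrow> enat"
  where "proj_dim R N = Inf {enat d | d.
    \<exists>(P :: nat \<Rightarrow> ('a, nat \<times> 'b \<Rightarrow> 'a) module) \<delta> \<epsilon>.
      projective_resolution R N P \<delta> \<epsilon> \<and> (\<forall>i>d. carrier (P i) = {\<zero>\<^bsub>P i\<^esub>})}"

text \<open>\<open>R/I\<close> as an \<open>R\<close>-module.\<close>
definition quotient_module :: "('a, 'r) ring_scheme \<Rightarrow> 'a set \<Rightarrow> ('a, 'a set) module"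
  where "quotient_module R I = ring.extend (R Quot I)
    (module.fields (\<lambda>r c. (I +>\<^bsub>R\<^esub> r) \<otimes>\<^bsub>R Quot I\<^esub> c))"

section \<open>Monomials and semidominant ideals\<close>

text \<open>
  The polynomial ring over \<open>'k\<close> with variables indexed by the finite type \<open>'x\<close>; a monomial is
  given by its exponent vector \<open>a :: 'x \<Rightarrow>\<^sub>0 nat\<close>. Divisibility is \<open>dvd\<close> in the ring.
\<close>
type_synonym ('x, 'k) mpoly = "('x \<Rightarrow>\<^sub>0 nat) \<Rightarrow>\<^sub>0 'k"

abbreviation mpoly_ring :: "('x, 'k :: field) mpoly ring"
  where "mpoly_ring \<equiv> ring_of_type_algebra"

definition monomial :: "('x \<Rightarrow>\<^sub>0 nat) \<Rightarrow> ('x, 'k :: field) mpoly"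
  where "monomial a = Poly_Mapping.single a 1"

definition Var :: "'x \<Rightarrow> ('x, 'k :: field) mpoly"
  where "Var x = monomial (Poly_Mapping.single x 1)"

text \<open>Exponent vector of the least common multiple; see \<open>monomial_lcm\<close> below.\<close>
lift_definition exp_lcm :: "('x \<Rightarrow>\<^sub>0 nat) \<Rightarrow> ('x \<Rightarrow>\<^sub>0 nat) \<Rightarrow> ('x \<Rightarrow>\<^sub>0 nat)"
  is "\<lambda>a b x. max (a x) (b x)"
  subgoal for a b by (rule finite_subset[of _ "{x. a x \<noteq> 0} \<union> {x. b x \<noteq> 0}"]) auto
  done

definition dominant :: "('x, 'k :: field) mpoly set \<Rightarrow> ('x, 'k) mpoly \<Rightarrow> bool"
  where "dominant G m \<longleftrightarrow> m \<in> G \<and>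
    (\<exists>x k. k \<ge> 1 \<and> Var x ^ k dvd m \<and> (\<forall>m'\<in>G - {m}. \<not> Var x ^ k dvd m'))"

definition semidominant :: "('x, 'k :: field) mpoly set \<Rightarrow> bool"
  where "semidominant G \<longleftrightarrow> (\<exists>!g. g \<in> G \<and> \<not> dominant G g)"

definition minimal_generating_set ::
  "('x :: finite, 'k :: field) mpoly set \<Rightarrow> ('x, 'k) mpoly set \<Rightarrow> bool"
  where "minimal_generating_set M G \<longleftrightarrow> G \<subseteq> range monomial \<and>
    Idl\<^bsub>mpoly_ring\<^esub> G = M \<and> (\<forall>H. H \<subset> G \<longrightarrow> Idl\<^bsub>mpoly_ring\<^esub> H \<noteq> M)"

definition semidominant_ideal :: "('x :: finite, 'k :: field) mpoly set \<Rightarrow> bool"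
  where "semidominant_ideal M \<longleftrightarrow> (\<exists>G. minimal_generating_set M G \<and> semidominant G)"

section \<open>Adequacy of the definitions\<close>

lemma module_quotient_module:
  assumes "cring R" "ideal I R"
  shows "module R (quotient_module R I)"
proof -
  interpret R: cring R by fact
  interpret I: ideal I R by fact
  interpret Q: cring "R Quot I" by (rule I.quotient_is_cring) (rule assms(1))
  have h: "(+>\<^bsub>R\<^esub>) I \<in> ring_hom R (R Quot I)" by (rule I.rcos_ring_hom)
  note hs = ring_hom_closed[OF h] ring_hom_mult[OF h] ring_hom_add[OF h] ring_hom_one[OF h]
  let ?M = "quotient_module R I"
  have M: "carrier ?M = carrier (R Quot I)" "add ?M = add (R Quot I)" "zero ?M = zero (R Quot I)"
    "module.smult ?M = (\<lambda>r c. (I +>\<^bsub>R\<^esub> r) \<otimes>\<^bsub>R Quot I\<^esub> c)"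
    by (simp_all add: quotient_module_def ring.extend_def module.fields_def)
  have "\<exists>y\<in>carrier (R Quot I). y \<oplus>\<^bsub>R Quot I\<^esub> x = \<zero>\<^bsub>R Quot I\<^esub>" if "x \<in> carrier (R Quot I)" for x
    using that Q.a_inv_closed Q.l_neg by blast
  then have "abelian_group ?M"
    by (intro abelian_groupI) (simp_all add: M Q.a_assoc, rule Q.a_comm)
  then show ?thesis
    by (intro moduleI assms(1)) (auto simp: M hs Q.l_distr Q.r_distr Q.m_assoc)
qed

lemma monomial_dvd_iff:
  "monomial a dvd (p :: ('x, 'k :: field) mpoly) \<longleftrightarrow>
    (\<forall>t\<in>Poly_Mapping.keys p. \<forall>x. Poly_Mapping.lookup a x \<le> Poly_Mapping.lookup t x)"
proof (intro iffI ballI allI)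
  fix t x assume "monomial a dvd p" and t: "t \<in> Poly_Mapping.keys p"
  then obtain q where "p = monomial a * q" by (elim dvdE)
  with t obtain a' b where "t = a' + b" "a' \<in> Poly_Mapping.keys (monomial a :: ('x, 'k) mpoly)"
    using keys_mult[of "monomial a" q] by blast
  then have "t = a + b" by (simp add: monomial_def)
  then show "Poly_Mapping.lookup a x \<le> Poly_Mapping.lookup t x" by (simp add: lookup_add)
next
  assume *: "\<forall>t\<in>Poly_Mapping.keys p. \<forall>x. Poly_Mapping.lookup a x \<le> Poly_Mapping.lookup t x"
  have "p = (\<Sum>t\<in>Poly_Mapping.keys p. Poly_Mapping.single t (Poly_Mapping.lookup p t))"
    by (rule poly_mapping_eqI) (auto simp: lookup_sum lookup_single when_def in_keys_iff)
  also have "monomial a dvd \<dots>"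
  proof (rule dvd_sum)
    fix t assume "t \<in> Poly_Mapping.keys p"
    then have "t = a + (t - a)"
      using * by (intro poly_mapping_eqI) (auto simp: lookup_add lookup_minus)
    then have "Poly_Mapping.single t (Poly_Mapping.lookup p t) =
        monomial a * Poly_Mapping.single (t - a) (Poly_Mapping.lookup p t)"
      by (simp add: monomial_def mult_single)
    then show "monomial a dvd Poly_Mapping.single t (Poly_Mapping.lookup p t)" by simp
  qed
  finally show "monomial a dvd p" .
qed

lemma monomial_lcm:
  fixes p :: "('x, 'k :: field) mpoly"
  shows "monomial (exp_lcm a b) dvd p \<longleftrightarrow> monomial a dvd p \<and> monomial b dvd p"
  by (auto simp: monomial_dvd_iff exp_lcm.rep_eq)

context
  fixes R :: "('a, 'r) ring_scheme" and J :: "'u set"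
begin

definition free_carrier :: "('u \<Rightarrow> 'a) set"
  where "free_carrier = {f. range f \<subseteq> carrier R \<and> finite {x. f x \<noteq> \<zero>\<^bsub>R\<^esub>} \<and>
    (\<forall>x. x \<notin> J \<longrightarrow> f x = \<zero>\<^bsub>R\<^esub>)}"

definition free_module :: "('a, 'u \<Rightarrow> 'a) module"
  where "free_module = \<lparr>carrier = free_carrier,
    monoid.mult = (\<lambda>f g. f), one = (\<lambda>x. \<zero>\<^bsub>R\<^esub>), zero = (\<lambda>x. \<zero>\<^bsub>R\<^esub>),
    add = (\<lambda>f g x. f x \<oplus>\<^bsub>R\<^esub> g x), module.smult = (\<lambda>r f x. r \<otimes>\<^bsub>R\<^esub> f x)\<rparr>"

definition free_eval :: "('a, 'b, 'm) module_scheme \<Rightarrow> ('u \<Rightarrow> 'b) \<Rightarrow> ('u \<Rightarrow> 'a) \<Rightarrow> 'b"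
  where "free_eval A e f = (\<Oplus>\<^bsub>A\<^esub>x\<in>{x. f x \<noteq> \<zero>\<^bsub>R\<^esub>}. f x \<odot>\<^bsub>A\<^esub> e x)"

end

lemma module_free_module:
  fixes R :: "('a, 'r) ring_scheme" and J :: "'u set"
  assumes "cring R"
  shows "module R (free_module R J)"
proof -
  interpret cring R by fact
  have fin: "finite {x. f x \<oplus>\<^bsub>R\<^esub> g x \<noteq> \<zero>\<^bsub>R\<^esub>}"
    if "finite {x. f x \<noteq> \<zero>\<^bsub>R\<^esub>}" "finite {x. g x \<noteq> \<zero>\<^bsub>R\<^esub>}" for f g :: "'u \<Rightarrow> 'a"
    using finite_UnI[OF that] by (rule rev_finite_subset) auto
  have fin2: "finite {x. r \<otimes>\<^bsub>R\<^esub> f x \<noteq> \<zero>\<^bsub>R\<^esub>}"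
    if "finite {x. f x \<noteq> \<zero>\<^bsub>R\<^esub>}" "r \<in> carrier R" for f :: "'u \<Rightarrow> 'a" and r
    using that(1) by (rule rev_finite_subset) (use that(2) in auto)
  have inv: "\<exists>g\<in>free_carrier R J. (\<lambda>x. g x \<oplus>\<^bsub>R\<^esub> f x) = (\<lambda>x. \<zero>\<^bsub>R\<^esub>)"
    if f: "f \<in> free_carrier R J" for f
  proof (rule bexI[of _ "\<lambda>x. \<ominus>\<^bsub>R\<^esub> f x"])
    have fc: "f x \<in> carrier R" for x using f by (auto simp: free_carrier_def)
    show "(\<lambda>x. \<ominus>\<^bsub>R\<^esub> f x \<oplus>\<^bsub>R\<^esub> f x) = (\<lambda>x. \<zero>\<^bsub>R\<^esub>)" using fc by (auto simp: l_neg)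
    have "finite {x. \<ominus>\<^bsub>R\<^esub> f x \<noteq> \<zero>\<^bsub>R\<^esub>}"
      by (rule rev_finite_subset[of "{x. f x \<noteq> \<zero>\<^bsub>R\<^esub>}"]) (use f in \<open>auto simp: free_carrier_def\<close>)
    then show "(\<lambda>x. \<ominus>\<^bsub>R\<^esub> f x) \<in> free_carrier R J" using f fc by (auto simp: free_carrier_def)
  qed
  have addc: "(\<lambda>x. f x \<oplus>\<^bsub>R\<^esub> g x) \<in> free_carrier R J"
    if "f \<in> free_carrier R J" "g \<in> free_carrier R J" for f g
    using that fin[of f g] by (simp add: free_carrier_def image_subset_iff)
  have fc: "f x \<in> carrier R" if "f \<in> free_carrier R J" for f x
    using that by (auto simp: free_carrier_def)
  have smc: "(\<lambda>x. r \<otimes>\<^bsub>R\<^esub> f x) \<in> free_carrier R J"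
    if "f \<in> free_carrier R J" "r \<in> carrier R" for f r
    using that fin2[of f r] by (simp add: free_carrier_def image_subset_iff)
  have zc: "(\<lambda>x. \<zero>\<^bsub>R\<^esub>) \<in> free_carrier R J" by (auto simp: free_carrier_def)
  have ag: "abelian_group (free_module R J)"
    by (intro abelian_groupI)
      (simp_all add: free_module_def inv addc zc fc a_assoc, simp add: fc a_comm)
  show ?thesis
    by (intro moduleI ag assms)
      (simp_all add: free_module_def smc fc l_distr r_distr m_assoc)
qed

lemma free_eval_superset:
  assumes "module R A" "e \<in> J \<rightarrow> carrier A" "f \<in> free_carrier R J"
    "finite Y" "{x. f x \<noteq> \<zero>\<^bsub>R\<^esub>} \<subseteq> Y" "Y \<subseteq> J"
  shows "free_eval R A e f = (\<Oplus>\<^bsub>A\<^esub>x\<in>Y. f x \<odot>\<^bsub>A\<^esub> e x)"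
proof -
  interpret module R A by fact
  show ?thesis unfolding free_eval_def
    by (rule M.add.finprod_mono_neutral_cong_left)
      (use assms(2-) in \<open>auto simp: free_carrier_def subset_iff image_subset_iff Pi_iff\<close>)
qed

lemma free_eval_hom:
  assumes "module R A" "e \<in> J \<rightarrow> carrier A"
  shows "free_eval R A e \<in> mod_hom R (free_module R J) A"
proof -
  interpret module R A by fact
  let ?s = "\<lambda>f. {x. f x \<noteq> \<zero>\<^bsub>R\<^esub>}"
  have F: "module R (free_module R J)" by (rule module_free_module) (rule R.is_cring)
  interpret F: module R "free_module R J" by fact
  have c: "f x \<in> carrier R" "finite (?s f)" "?s f \<subseteq> J" if "f \<in> free_carrier R J" for f x
    using that by (auto simp: free_carrier_def)
  have ex: "e x \<in> carrier A" if "x \<in> J" for x using assms(2) that by auto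
  note sup = free_eval_superset[OF assms]
  have Fc: "carrier (free_module R J) = free_carrier R J"
    "add (free_module R J) = (\<lambda>f g x. f x \<oplus>\<^bsub>R\<^esub> g x)"
    "module.smult (free_module R J) = (\<lambda>r f x. r \<otimes>\<^bsub>R\<^esub> f x)"
    by (simp_all add: free_module_def)
  have clo: "free_eval R A e f \<in> carrier A" if "f \<in> free_carrier R J" for f
    unfolding free_eval_def using c[OF that] ex by (intro M.finsum_closed) auto
  have add: "free_eval R A e (\<lambda>x. f x \<oplus>\<^bsub>R\<^esub> g x) = free_eval R A e f \<oplus>\<^bsub>A\<^esub> free_eval R A e g"
    if f: "f \<in> free_carrier R J" and g: "g \<in> free_carrier R J" for f g
  proof -
    let ?Y = "?s f \<union> ?s g"
    have fg: "(\<lambda>x. f x \<oplus>\<^bsub>R\<^esub> g x) \<in> free_carrier R J"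
      using F.M.a_closed f g by (simp add: Fc)
    have Y: "finite ?Y" "?Y \<subseteq> J" using c[OF f] c[OF g] by auto
    have "free_eval R A e (\<lambda>x. f x \<oplus>\<^bsub>R\<^esub> g x) = (\<Oplus>\<^bsub>A\<^esub>x\<in>?Y. (f x \<oplus>\<^bsub>R\<^esub> g x) \<odot>\<^bsub>A\<^esub> e x)"
      by (rule sup[OF fg Y(1) _ Y(2)]) auto
    also have "\<dots> = (\<Oplus>\<^bsub>A\<^esub>x\<in>?Y. f x \<odot>\<^bsub>A\<^esub> e x \<oplus>\<^bsub>A\<^esub> g x \<odot>\<^bsub>A\<^esub> e x)"
      using c[OF f] c[OF g] ex Y(2)
      by (intro M.finsum_cong') (auto simp: smult_l_distr subset_iff)
    also have "\<dots> = (\<Oplus>\<^bsub>A\<^esub>x\<in>?Y. f x \<odot>\<^bsub>A\<^esub> e x) \<oplus>\<^bsub>A\<^esub> (\<Oplus>\<^bsub>A\<^esub>x\<in>?Y. g x \<odot>\<^bsub>A\<^esub> e x)"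
      using c[OF f] c[OF g] ex Y(2) by (intro M.finsum_addf) auto
    also have "\<dots> = free_eval R A e f \<oplus>\<^bsub>A\<^esub> free_eval R A e g"
      using sup[OF f Y(1) _ Y(2)] sup[OF g Y(1) _ Y(2)] by simp
    finally show ?thesis .
  qed
  have smu: "free_eval R A e (\<lambda>x. r \<otimes>\<^bsub>R\<^esub> f x) = r \<odot>\<^bsub>A\<^esub> free_eval R A e f"
    if f: "f \<in> free_carrier R J" and r: "r \<in> carrier R" for f r
  proof -
    have rf: "(\<lambda>x. r \<otimes>\<^bsub>R\<^esub> f x) \<in> free_carrier R J"
      using F.smult_closed f r by (simp add: Fc)
    have "free_eval R A e (\<lambda>x. r \<otimes>\<^bsub>R\<^esub> f x) = (\<Oplus>\<^bsub>A\<^esub>x\<in>?s f. (r \<otimes>\<^bsub>R\<^esub> f x) \<odot>\<^bsub>A\<^esub> e x)"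
      by (rule sup[OF rf c(2)[OF f] _ c(3)[OF f]]) (use r in auto)
    also have "\<dots> = (\<Oplus>\<^bsub>A\<^esub>x\<in>?s f. r \<odot>\<^bsub>A\<^esub> (f x \<odot>\<^bsub>A\<^esub> e x))"
      using c[OF f] ex r by (intro M.finsum_cong') (auto simp: smult_assoc1 subset_iff)
    also have "\<dots> = r \<odot>\<^bsub>A\<^esub> free_eval R A e f"
      unfolding free_eval_def
      using c[OF f] ex r by (intro finsum_smult_ldistr[symmetric]) auto
    finally show ?thesis .
  qed
  show ?thesis using clo add smu by (auto simp: mod_hom_def Fc)
qed

lemma mod_hom_zero:
  assumes "module R A" "module R B" "g \<in> mod_hom R A B"
  shows "g \<zero>\<^bsub>A\<^esub> = \<zero>\<^bsub>B\<^esub>"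
proof -
  interpret A: module R A by fact
  interpret B: module R B by fact
  have g: "g \<zero>\<^bsub>A\<^esub> \<in> carrier B" "g (\<zero>\<^bsub>R\<^esub> \<odot>\<^bsub>A\<^esub> \<zero>\<^bsub>A\<^esub>) = \<zero>\<^bsub>R\<^esub> \<odot>\<^bsub>B\<^esub> g \<zero>\<^bsub>A\<^esub>"
    using assms(3) A.R.zero_closed A.M.zero_closed unfolding mod_hom_def by blast+
  then show ?thesis by simp
qed

lemma free_eval_natural:
  assumes A: "module R A" and B: "module R B" and g: "g \<in> mod_hom R A B"
    and e: "e \<in> J \<rightarrow> carrier A" and f: "f \<in> free_carrier R J"
  shows "g (free_eval R A e f) = free_eval R B (\<lambda>x. g (e x)) f"
proof -
  interpret A: module R A by fact
  interpret B: module R B by fact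
  have ga: "g x \<in> carrier B" if "x \<in> carrier A" for x using g that by (auto simp: mod_hom_def)
  have "g (\<Oplus>\<^bsub>A\<^esub>x\<in>Y. f x \<odot>\<^bsub>A\<^esub> e x) = (\<Oplus>\<^bsub>B\<^esub>x\<in>Y. f x \<odot>\<^bsub>B\<^esub> g (e x))"
    if "finite Y" "Y \<subseteq> J" for Y
    using that
  proof (induction Y rule: finite_induct)
    case empty
    then show ?case using mod_hom_zero[OF A B g] by simp
  next
    case (insert y Y)
    have fr: "f x \<in> carrier R" for x using f by (auto simp: free_carrier_def)
    have eY: "e x \<in> carrier A" if "x \<in> insert y Y" for x using e insert.prems that by auto
    have mem: "f y \<odot>\<^bsub>A\<^esub> e y \<in> carrier A" "(\<Oplus>\<^bsub>A\<^esub>x\<in>Y. f x \<odot>\<^bsub>A\<^esub> e x) \<in> carrier A"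
      using fr eY by (auto intro!: A.M.finsum_closed)
    have "g (\<Oplus>\<^bsub>A\<^esub>x\<in>insert y Y. f x \<odot>\<^bsub>A\<^esub> e x) =
        g (f y \<odot>\<^bsub>A\<^esub> e y \<oplus>\<^bsub>A\<^esub> (\<Oplus>\<^bsub>A\<^esub>x\<in>Y. f x \<odot>\<^bsub>A\<^esub> e x))"
      using insert.hyps fr eY by (subst A.M.finsum_insert) auto
    also have "\<dots> = g (f y \<odot>\<^bsub>A\<^esub> e y) \<oplus>\<^bsub>B\<^esub> g (\<Oplus>\<^bsub>A\<^esub>x\<in>Y. f x \<odot>\<^bsub>A\<^esub> e x)"
      using g mem by (auto simp: mod_hom_def)
    also have "\<dots> = f y \<odot>\<^bsub>B\<^esub> g (e y) \<oplus>\<^bsub>B\<^esub> (\<Oplus>\<^bsub>B\<^esub>x\<in>Y. f x \<odot>\<^bsub>B\<^esub> g (e x))"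
      using g fr eY insert by (auto simp: mod_hom_def)
    also have "\<dots> = (\<Oplus>\<^bsub>B\<^esub>x\<in>insert y Y. f x \<odot>\<^bsub>B\<^esub> g (e x))"
      using insert.hyps fr eY ga by (subst B.M.finsum_insert) auto
    finally show ?case .
  qed
  then show ?thesis using f by (auto simp: free_eval_def free_carrier_def)
qed

lemma projective_module_lift:
  fixes P :: "('a, 'u) module" and A :: "('a, 'b) module" and B :: "('a, 'c) module"
  assumes P: "projective_module R P" and A: "module R A" and B: "module R B"
    and g: "g \<in> mod_hom R A B" "g ` carrier A = carrier B" and f: "f \<in> mod_hom R P B"
  shows "\<exists>h\<in>mod_hom R P A. \<forall>x\<in>carrier P. g (h x) = f x"
proof -
  have P': "module R P" using P by (simp add: projective_module_def)
  interpret P: module R P by fact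
  let ?J = "carrier P"
  let ?F = "free_module R ?J"
  have F: "module R ?F" by (rule module_free_module) (rule P.R.is_cring)
  have Fc: "carrier ?F = free_carrier R ?J" by (simp add: free_module_def)
  let ?p = "free_eval R P (\<lambda>x. x)"
  have p: "?p \<in> mod_hom R ?F P" by (rule free_eval_hom[OF P']) auto
  have surj: "?p ` carrier ?F = carrier P"
  proof (intro equalityI subsetI)
    fix y assume y: "y \<in> carrier P"
    let ?d = "\<lambda>x. if x = y then \<one>\<^bsub>R\<^esub> else \<zero>\<^bsub>R\<^esub>"
    have d: "?d \<in> free_carrier R ?J" using y by (auto simp: free_carrier_def)
    have "?p ?d = (\<Oplus>\<^bsub>P\<^esub>x\<in>{y}. ?d x \<odot>\<^bsub>P\<^esub> x)"
      by (rule free_eval_superset[OF P' _ d]) (use y in auto)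
    also have "\<dots> = y" using y by (subst P.M.finsum_insert) auto
    finally show "y \<in> ?p ` carrier ?F" using d Fc by (metis imageI)
  qed (use p in \<open>auto simp: mod_hom_def\<close>)
  have id: "(\<lambda>x. x) \<in> mod_hom R P P" by (auto simp: mod_hom_def)
  have "\<exists>s\<in>mod_hom R P ?F. \<forall>x\<in>carrier P. ?p (s x) = x"
    using P[unfolded projective_module_def, THEN conjunct2, rule_format, OF p id F P' surj] .
  then obtain s where s: "s \<in> mod_hom R P ?F" "\<forall>x\<in>carrier P. ?p (s x) = x" by blast
  have "\<forall>x\<in>?J. \<exists>a\<in>carrier A. g a = f x"
  proof
    fix x assume "x \<in> ?J"
    then have "f x \<in> g ` carrier A" using f g(2) by (auto simp: mod_hom_def)
    then show "\<exists>a\<in>carrier A. g a = f x" by (auto simp: image_iff)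
  qed
  then obtain e where e: "\<forall>x\<in>?J. e x \<in> carrier A \<and> g (e x) = f x" by metis
  have e': "e \<in> ?J \<rightarrow> carrier A" using e by auto
  let ?h = "\<lambda>x. free_eval R A e (s x)"
  have h: "?h \<in> mod_hom R P A"
    using s(1) free_eval_hom[OF A e'] by (auto simp: mod_hom_def Pi_iff)
  have gh: "g (?h x) = f x" if x: "x \<in> carrier P" for x
  proof -
    interpret B: module R B by fact
    have sx: "s x \<in> free_carrier R ?J" using s(1) x Fc by (auto simp: mod_hom_def)
    have "g (?h x) = free_eval R B (\<lambda>x. g (e x)) (s x)"
      by (rule free_eval_natural[OF A B g(1) e' sx])
    also have "\<dots> = free_eval R B f (s x)"
      unfolding free_eval_def
    proof (intro B.M.finsum_cong' refl)
      fix i assume "i \<in> {i. s x i \<noteq> \<zero>\<^bsub>R\<^esub>}"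
      then have "i \<in> ?J" using sx by (auto simp: free_carrier_def)
      then show "s x i \<odot>\<^bsub>B\<^esub> g (e i) = s x i \<odot>\<^bsub>B\<^esub> f i" using e by simp
    qed (use sx f in \<open>auto simp: free_carrier_def mod_hom_def Pi_iff subset_iff image_subset_iff\<close>)
    also have "\<dots> = f (?p (s x))"
      by (rule free_eval_natural[OF P' B f _ sx, symmetric]) auto
    also have "\<dots> = f x" using s(2) x by simp
    finally show ?thesis .
  qed
  show ?thesis by (intro bexI[OF _ h] ballI gh)
qed

end

theory Submission
  imports Defs
begin

text \<open>
  Let \<open>S\<close> be the polynomial ring, put \<open>g 0 = n\<close> and \<open>g i = m i\<close>, and call \<open>\<sigma>_ij\<close> the syzygy
  \<open>(lcm/g i) e_i - (lcm/g j) e_j\<close> of two of these monomials, where \<open>lcm = lcm(g i, g j)\<close>.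

  \<^bold>\<open>The condition is sufficient.\<close> In a relation \<open>\<Sum> f_i g_i = 0\<close> every term of \<open>f_i m_i\<close> cancels
  against a multiple of some other generator, so it is a multiple of \<open>n\<close> or of \<open>lcm(m_i, m_j)\<close>
  for some \<open>j \<noteq> i\<close>. If \<open>n\<close> divides all these least common multiples, then \<open>n\<close> divides the term in
  either case, so \<open>f_i\<close> is a multiple of \<open>lcm(m_i, n)/m_i\<close>. Hence the \<open>\<sigma>_i0\<close>, which are
  independent, form a basis of the module of syzygies
  (\<open>syzygies_at_common_divisor\<close>), and \<open>0 \<rightarrow> S^q \<rightarrow> S^(q+1) \<rightarrow> S \<rightarrow> S/M \<rightarrow> 0\<close> is exact
  (\<open>length_two_resolution\<close>).

  \<^bold>\<open>Lower bounds.\<close> Let \<open>\<dots> \<rightarrow> P_1 \<rightarrow> P_0 \<rightarrow> S/M \<rightarrow> 0\<close> be any projective resolution. Exactness of \<open>P\<close>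
  gives elements \<open>p_i\<close> of \<open>P_1\<close> that lie over the generators and elements \<open>y_ij\<close> of \<open>P_2\<close> that lie
  over the \<open>\<sigma>_ij\<close>. Projectivity of \<open>P_0\<close> and \<open>P_1\<close> gives a map back from \<open>P_1\<close> to \<open>S^(q+1)\<close>. With it,
  an equation \<open>y_ij = b u + c v\<close> in \<open>P_2\<close>, where \<open>b\<close> and \<open>c\<close> divide the two coefficients of \<open>\<sigma>_ij\<close>,
  becomes an equation \<open>\<sigma>_ij = b z + c z'\<close> between syzygies of the generators
  (\<open>syzygy_lift_exists\<close>). Comparing a single coefficient shows that such an equation is often
  impossible (\<open>no_syzygy_factor\<close>).

  If \<open>P_2 = 0\<close>, then \<open>y_ij = b 0 + c 0\<close> is such an equation with \<open>b\<close> and \<open>c\<close> the coefficients of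
  \<open>\<sigma>_ij\<close> themselves, and it contradicts that no generator divides another one. So the projective dimension
  is at least two (\<open>length_one_impossible\<close>).

  If \<open>P_3 = 0\<close> and \<open>n\<close> does not divide \<open>lcm(m_i, m_j)\<close>, then with
  \<open>T = lcm(m_i, m_j, n)\<close> the relation between \<open>\<sigma>_ij\<close>, \<open>\<sigma>_j0\<close> and \<open>\<sigma>_0i\<close> with coefficients
  \<open>T/lcm(m_i, m_j)\<close>, \<open>T/lcm(m_j, n)\<close> and \<open>T/lcm(m_i, n)\<close> holds for \<open>y_ij\<close>, \<open>y_j0\<close> and \<open>y_0i\<close> too.
  These coefficients are pairwise coprime, and \<open>P_2\<close> is projective, so \<open>y_ij\<close> is a combination of
  multiples of the last two coefficients (\<open>projective_module_relation\<close>). Dominance of \<open>m_i\<close>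
  and \<open>m_j\<close> makes both of them proper, and dominance of the other \<open>m_k\<close> keeps the \<open>m_k\<close>
  from dividing \<open>lcm(m_i, m_j)\<close>, so that comparing the coefficients at \<open>e_i\<close> gives a contradiction
  again (\<open>length_two_impossible\<close>).
\<close>

section \<open>Monomials and their multiples\<close>

abbreviation exp_le :: "('x \<Rightarrow>\<^sub>0 nat) \<Rightarrow> ('x \<Rightarrow>\<^sub>0 nat) \<Rightarrow> bool"  (infix \<open>\<preceq>\<close> 50)
  where "a \<preceq> b \<equiv> \<forall>x. Poly_Mapping.lookup a x \<le> Poly_Mapping.lookup b x"

lemma lookup_exp_lcm [simp]:
  "Poly_Mapping.lookup (exp_lcm a b) x = max (Poly_Mapping.lookup a x) (Poly_Mapping.lookup b x)"
  by (simp add: exp_lcm.rep_eq)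

lemma exp_le_antisym: "a \<preceq> b \<Longrightarrow> b \<preceq> a \<Longrightarrow> a = b"
  by (intro poly_mapping_eqI) (simp add: order_antisym)

lemma monomial_dvd_monomial_iff:
  "(monomial a :: ('x, 'k :: field) mpoly) dvd monomial b \<longleftrightarrow> a \<preceq> b"
  by (simp add: monomial_dvd_iff) (simp add: monomial_def)

lemma monomial_eq_iff: "(monomial a :: ('x, 'k :: field) mpoly) = monomial b \<longleftrightarrow> a = b"
  by (metis exp_le_antisym monomial_dvd_monomial_iff dvd_refl)

lemma monomial_mult: "(monomial a :: ('x, 'k :: field) mpoly) * monomial b = monomial (a + b)"
  by (simp add: monomial_def mult_single)

lemma exp_le_add: "a \<preceq> a + b"
  by (simp add: lookup_add)

lemma exp_add_diff: "a \<preceq> b \<Longrightarrow> a + (b - a) = b"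
  by (intro poly_mapping_eqI) (auto simp: lookup_add lookup_minus)

lemma monomial_mult_diff:
  "a \<preceq> b \<Longrightarrow> (monomial a :: ('x, 'k :: field) mpoly) * monomial (b - a) = monomial b"
  by (simp add: monomial_mult exp_add_diff)

lemma lookup_monomial_mult:
  fixes p :: "('x, 'k :: field) mpoly"
  shows "Poly_Mapping.lookup (monomial a * p) (a + t) = Poly_Mapping.lookup p t"
  by (simp add: monomial_def lookup_mult lookup_single when_mult)

lemma keys_monomial_mult:
  fixes p :: "('x, 'k :: field) mpoly"
  shows "Poly_Mapping.keys (monomial a * p) = (+) a ` Poly_Mapping.keys p"
proof (intro equalityI subsetI)
  fix s assume "s \<in> Poly_Mapping.keys (monomial a * p)"
  then obtain t where "s = a + t"
    using keys_mult[of "monomial a" p] by (auto simp: monomial_def)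
  with \<open>s \<in> _\<close> show "s \<in> (+) a ` Poly_Mapping.keys p"
    by (auto simp: in_keys_iff lookup_monomial_mult)
qed (auto simp: in_keys_iff lookup_monomial_mult)

lemma monomial_mult_eq_0_iff:
  fixes p :: "('x, 'k :: field) mpoly"
  shows "monomial a * p = 0 \<longleftrightarrow> p = 0"
proof
  assume "monomial a * p = 0"
  then have "Poly_Mapping.lookup p t = 0" for t
    by (metis lookup_monomial_mult lookup_zero)
  then show "p = 0" by (intro poly_mapping_eqI) simp
qed simp

lemma keys_sum_subset:
  fixes f :: "'i \<Rightarrow> ('x, 'k :: field) mpoly"
  shows "Poly_Mapping.keys (sum f A) \<subseteq> (\<Union>i\<in>A. Poly_Mapping.keys (f i))"
proof
  fix t assume "t \<in> Poly_Mapping.keys (sum f A)"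
  then have "(\<Sum>i\<in>A. Poly_Mapping.lookup (f i) t) \<noteq> 0" by (simp add: in_keys_iff lookup_sum)
  then obtain i where "i \<in> A" "Poly_Mapping.lookup (f i) t \<noteq> 0" by (rule sum.not_neutral_contains_not_neutral)
  then show "t \<in> (\<Union>i\<in>A. Poly_Mapping.keys (f i))" by (auto simp: in_keys_iff)
qed

text \<open>
  Split the terms of the polynomial according to which of the two monomials divides them.
\<close>
lemma in_monomial_pair_ideal:
  fixes p :: "('x, 'k :: field) mpoly"
  assumes "\<And>t. t \<in> Poly_Mapping.keys p \<Longrightarrow> b \<preceq> t \<or> c \<preceq> t"
  shows "\<exists>y z. p = monomial b * y + monomial c * z"
proof -
  let ?K = "Poly_Mapping.keys p"
  let ?s = "\<lambda>A. \<Sum>t\<in>A. Poly_Mapping.single t (Poly_Mapping.lookup p t)"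
  have key: "u \<in> A" if "finite A" "u \<in> Poly_Mapping.keys (?s A)" for A u
    using that by (auto simp: in_keys_iff lookup_sum lookup_single when_def split: if_splits)
  have "p = ?s ?K"
    by (rule poly_mapping_eqI) (auto simp: lookup_sum lookup_single when_def in_keys_iff)
  also have "\<dots> = ?s (?K \<inter> {t. b \<preceq> t}) + ?s (?K - {t. b \<preceq> t})"
    by (simp add: sum.Int_Diff[symmetric])
  finally have "p = ?s (?K \<inter> {t. b \<preceq> t}) + ?s (?K - {t. b \<preceq> t})" .
  moreover have "monomial b dvd ?s (?K \<inter> {t. b \<preceq> t})"
    unfolding monomial_dvd_iff
  proof
    fix u assume "u \<in> Poly_Mapping.keys (?s (?K \<inter> {t. b \<preceq> t}))"
    from key[OF _ this] show "b \<preceq> u" by simp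
  qed
  moreover have "monomial c dvd ?s (?K - {t. b \<preceq> t})"
    unfolding monomial_dvd_iff
  proof
    fix u assume "u \<in> Poly_Mapping.keys (?s (?K - {t. b \<preceq> t}))"
    from key[OF _ this] have "u \<in> ?K - {t. b \<preceq> t}" by simp
    then show "c \<preceq> u" using assms[of u] by blast
  qed
  ultimately obtain p1 p2 where "p = p1 + p2" "monomial b dvd p1" "monomial c dvd p2" by blast
  then show ?thesis by (elim dvdE) blast
qed

text \<open>
  A term of \<open>r\<close>, multiplied by the monomial \<open>a\<close>, has to cancel against a multiple of \<open>b\<close> or of \<open>c\<close>;
  as \<open>a\<close> shares no variable with these, the term itself is a multiple of one of them.
  This is the hypothesis on the ring in \<open>projective_module_relation\<close>.
\<close>
lemma coprime_relation:
  fixes r s t :: "('x, 'k :: field) mpoly"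
  assumes rel: "monomial a * r + monomial b * s + monomial c * t = 0"
    and cop: "\<And>x. Poly_Mapping.lookup a x = 0 \<or> Poly_Mapping.lookup b x = 0"
      "\<And>x. Poly_Mapping.lookup a x = 0 \<or> Poly_Mapping.lookup c x = 0"
  shows "\<exists>y z. r = monomial b * y + monomial c * z"
proof (rule in_monomial_pair_ideal)
  fix u assume u: "u \<in> Poly_Mapping.keys r"
  have "a + u \<in> Poly_Mapping.keys (monomial a * r)" using u by (simp add: keys_monomial_mult)
  also have "monomial a * r = - (monomial b * s + monomial c * t)"
    unfolding eq_neg_iff_add_eq_0 using rel by (simp only: add.assoc)
  finally have "a + u \<in> Poly_Mapping.keys (monomial b * s + monomial c * t)"
    by (simp add: in_keys_iff lookup_add lookup_minus neg_eq_iff_add_eq_0)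
  then obtain s' where "a + u = b + s' \<or> a + u = c + s'"
    using Poly_Mapping.keys_add[of "monomial b * s" "monomial c * t"]
    by (auto simp: keys_monomial_mult)
  then have "b \<preceq> a + u \<or> c \<preceq> a + u"
    using exp_le_add[of b s'] exp_le_add[of c s'] by (elim disj_forward) simp_all
  then show "b \<preceq> u \<or> c \<preceq> u"
  proof (elim disj_forward)
    assume "b \<preceq> a + u"
    show "b \<preceq> u"
    proof
      fix x from \<open>b \<preceq> a + u\<close> cop(1)[of x] show "Poly_Mapping.lookup b x \<le> Poly_Mapping.lookup u x"
        by (auto simp: lookup_add dest: spec[of _ x])
    qed
  next
    assume "c \<preceq> a + u"
    show "c \<preceq> u"
    proof
      fix x from \<open>c \<preceq> a + u\<close> cop(2)[of x] show "Poly_Mapping.lookup c x \<le> Poly_Mapping.lookup u x"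
        by (auto simp: lookup_add dest: spec[of _ x])
    qed
  qed
qed

section \<open>Maps between modules, free and projective modules\<close>

lemma mod_homD:
  assumes "h \<in> mod_hom R A B"
  shows "x \<in> carrier A \<Longrightarrow> h x \<in> carrier B"
    and "x \<in> carrier A \<Longrightarrow> y \<in> carrier A \<Longrightarrow> h (x \<oplus>\<^bsub>A\<^esub> y) = h x \<oplus>\<^bsub>B\<^esub> h y"
    and "r \<in> carrier R \<Longrightarrow> x \<in> carrier A \<Longrightarrow> h (r \<odot>\<^bsub>A\<^esub> x) = r \<odot>\<^bsub>B\<^esub> h x"
  using assms by (auto simp: mod_hom_def)

lemma mod_hom_comp:
  assumes "f \<in> mod_hom R A B" "g \<in> mod_hom R B C"
  shows "(\<lambda>x. g (f x)) \<in> mod_hom R A C"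
  using assms by (auto simp: mod_hom_def Pi_iff)

text \<open>
  A lift is determined by choosing preimages of the images of the unit vectors \<open>d j\<close>. The work is to
  see that every element of the free module is the combination of unit vectors that \<open>free_eval\<close> forms.
\<close>
lemma projective_free_module:
  fixes R :: "('a, 'r) ring_scheme" and J :: "'u set"
  assumes "cring R"
  shows "projective_module R (free_module R J)"
  unfolding projective_module_def
proof (intro conjI allI ballI impI)
  interpret cring R by fact
  let ?F = "free_module R J"
  show F: "module R ?F" by (rule module_free_module[OF assms])
  fix A :: "('a, ('u \<Rightarrow> 'a) \<Rightarrow> 'a) module" and B :: "('a, 'u \<Rightarrow> 'a) module" and g f
  assume g: "g \<in> mod_hom R A B" and f: "f \<in> mod_hom R ?F B"
    and A: "module R A" and B: "module R B" and surj: "g ` carrier A = carrier B"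
  interpret F: module R ?F by (rule F)
  interpret B: module R B by (rule B)
  define d :: "'u \<Rightarrow> 'u \<Rightarrow> 'a" where "d = (\<lambda>j i. if i = j then \<one>\<^bsub>R\<^esub> else \<zero>\<^bsub>R\<^esub>)"
  have Fc: "carrier ?F = free_carrier R J" by (simp add: free_module_def)
  have d: "d j \<in> carrier ?F" if "j \<in> J" for j
    using that by (auto simp: Fc free_carrier_def d_def)
  have "\<forall>j\<in>J. \<exists>a\<in>carrier A. g a = f (d j)"
  proof
    fix j assume "j \<in> J"
    then have "f (d j) \<in> g ` carrier A" using surj mod_homD(1)[OF f d] by simp
    then show "\<exists>a\<in>carrier A. g a = f (d j)" by (auto simp: image_iff)
  qed
  then obtain e where e: "\<And>j. j \<in> J \<Longrightarrow> e j \<in> carrier A \<and> g (e j) = f (d j)" by metis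
  have app: "\<zero>\<^bsub>?F\<^esub> i = \<zero>\<^bsub>R\<^esub>" for i by (simp add: free_module_def)
  have eA: "e \<in> J \<rightarrow> carrier A" using e by auto
  have expand: "free_eval R ?F d x = x" if x: "x \<in> free_carrier R J" for x
  proof
    fix i
    have fin: "finite {j. x j \<noteq> \<zero>\<^bsub>R\<^esub>}" and sub: "{j. x j \<noteq> \<zero>\<^bsub>R\<^esub>} \<subseteq> J" and xc: "\<And>j. x j \<in> carrier R"
      using x by (auto simp: free_carrier_def)
    have "(\<Oplus>\<^bsub>?F\<^esub>j\<in>Y. x j \<odot>\<^bsub>?F\<^esub> d j) i = (if i \<in> Y then x i else \<zero>\<^bsub>R\<^esub>)"
      if "finite Y" "Y \<subseteq> J" for Y
      using that
    proof (induction Y rule: finite_induct)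
      case empty
      then show ?case using app by simp
    next
      case (insert y Y)
      have "(\<Oplus>\<^bsub>?F\<^esub>j\<in>insert y Y. x j \<odot>\<^bsub>?F\<^esub> d j) =
          x y \<odot>\<^bsub>?F\<^esub> d y \<oplus>\<^bsub>?F\<^esub> (\<Oplus>\<^bsub>?F\<^esub>j\<in>Y. x j \<odot>\<^bsub>?F\<^esub> d j)"
        using insert.hyps insert.prems xc d by (intro F.M.finsum_insert) auto
      moreover have "(p \<oplus>\<^bsub>?F\<^esub> q) i = p i \<oplus>\<^bsub>R\<^esub> q i" "(r \<odot>\<^bsub>?F\<^esub> p) i = r \<otimes>\<^bsub>R\<^esub> p i" for p q r
        by (simp_all add: free_module_def)
      ultimately show ?case using insert xc by (auto simp: d_def)
    qed
    from this[OF fin sub] show "free_eval R ?F d x i = x i" by (simp add: free_eval_def)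
  qed
  have "g (free_eval R A e x) = f x" if x: "x \<in> carrier ?F" for x
  proof -
    have x': "x \<in> free_carrier R J" using x Fc by simp
    have "g (free_eval R A e x) = free_eval R B (\<lambda>j. g (e j)) x"
      by (rule free_eval_natural[OF A B g eA x'])
    also have "\<dots> = free_eval R B (\<lambda>j. f (d j)) x"
      unfolding free_eval_def
    proof (intro B.M.finsum_cong' refl)
      fix j assume "j \<in> {j. x j \<noteq> \<zero>\<^bsub>R\<^esub>}"
      then have "j \<in> J" using x' by (auto simp: free_carrier_def)
      then show "x j \<odot>\<^bsub>B\<^esub> g (e j) = x j \<odot>\<^bsub>B\<^esub> f (d j)" using e by simp
    qed (use x' mod_homD(1)[OF f d] in \<open>auto simp: free_carrier_def image_subset_iff Pi_iff\<close>)
    also have "\<dots> = f (free_eval R ?F d x)"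
      by (rule free_eval_natural[OF F B f _ x', symmetric]) (use d in auto)
    also have "\<dots> = f x" using expand[OF x'] by simp
    finally show ?thesis .
  qed
  then show "\<exists>h\<in>mod_hom R ?F A. \<forall>x\<in>carrier ?F. g (h x) = f x"
    using free_eval_hom[OF A eA] by blast
qed

text \<open>
  A projective module is a direct summand of a free one, so membership in \<open>b P + c P\<close> can be decided
  coordinatewise: the relation holds in every coordinate of a free cover, and there it is a relation
  in the ring.
\<close>
lemma projective_module_relation:
  fixes R :: "('a, 'r) ring_scheme" and P :: "('a, 'u) module"
  assumes P: "projective_module R P"
    and abc: "a \<in> carrier R" "b \<in> carrier R" "c \<in> carrier R"
    and uvw: "u \<in> carrier P" "v \<in> carrier P" "w \<in> carrier P"
    and rel: "a \<odot>\<^bsub>P\<^esub> u \<oplus>\<^bsub>P\<^esub> b \<odot>\<^bsub>P\<^esub> v \<oplus>\<^bsub>P\<^esub> c \<odot>\<^bsub>P\<^esub> w = \<zero>\<^bsub>P\<^esub>"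
    and ring: "\<And>r s t. r \<in> carrier R \<Longrightarrow> s \<in> carrier R \<Longrightarrow> t \<in> carrier R \<Longrightarrow>
      a \<otimes>\<^bsub>R\<^esub> r \<oplus>\<^bsub>R\<^esub> b \<otimes>\<^bsub>R\<^esub> s \<oplus>\<^bsub>R\<^esub> c \<otimes>\<^bsub>R\<^esub> t = \<zero>\<^bsub>R\<^esub> \<Longrightarrow>
      \<exists>y\<in>carrier R. \<exists>z\<in>carrier R. r = b \<otimes>\<^bsub>R\<^esub> y \<oplus>\<^bsub>R\<^esub> c \<otimes>\<^bsub>R\<^esub> z"
  shows "\<exists>y\<in>carrier P. \<exists>z\<in>carrier P. u = b \<odot>\<^bsub>P\<^esub> y \<oplus>\<^bsub>P\<^esub> c \<odot>\<^bsub>P\<^esub> z"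
proof -
  have P': "module R P" using P by (simp add: projective_module_def)
  interpret P: module R P by fact
  let ?F = "free_module R (carrier P)" and ?p = "free_eval R P (\<lambda>x. x)"
  have F: "module R ?F" by (rule module_free_module) (rule P.R.is_cring)
  interpret F: module R ?F by fact
  have Fc: "carrier ?F = free_carrier R (carrier P)" by (simp add: free_module_def)
  have app: "(f \<oplus>\<^bsub>?F\<^esub> g) x = f x \<oplus>\<^bsub>R\<^esub> g x" "(r \<odot>\<^bsub>?F\<^esub> f) x = r \<otimes>\<^bsub>R\<^esub> f x" "\<zero>\<^bsub>?F\<^esub> x = \<zero>\<^bsub>R\<^esub>" for f g r x
    by (simp_all add: free_module_def)
  have p: "?p \<in> mod_hom R ?F P" by (rule free_eval_hom[OF P']) auto
  have "x \<in> ?p ` carrier ?F" if x: "x \<in> carrier P" for x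
  proof -
    let ?d = "\<lambda>y. if y = x then \<one>\<^bsub>R\<^esub> else \<zero>\<^bsub>R\<^esub>"
    have d: "?d \<in> free_carrier R (carrier P)" using x by (auto simp: free_carrier_def)
    have "?p ?d = (\<Oplus>\<^bsub>P\<^esub>y\<in>{x}. ?d y \<odot>\<^bsub>P\<^esub> y)"
      by (rule free_eval_superset[OF P' _ d]) (use x in auto)
    also have "\<dots> = x" using x by (subst P.M.finsum_insert) auto
    finally show ?thesis using d Fc by (metis imageI)
  qed
  then have surj: "?p ` carrier ?F = carrier P" using mod_homD(1)[OF p] by auto
  have id: "(\<lambda>x. x) \<in> mod_hom R P P" by (auto simp: mod_hom_def)
  obtain s where s: "s \<in> mod_hom R P ?F" and ps: "\<And>x. x \<in> carrier P \<Longrightarrow> ?p (s x) = x"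
    using projective_module_lift[OF P F P' p surj id] by blast
  have sc: "s x \<in> free_carrier R (carrier P)" if "x \<in> carrier P" for x
    using mod_homD(1)[OF s that] Fc by simp
  have sr: "s x i \<in> carrier R" if "x \<in> carrier P" for x i
    using sc[OF that] by (auto simp: free_carrier_def)
  have "a \<odot>\<^bsub>?F\<^esub> s u \<oplus>\<^bsub>?F\<^esub> b \<odot>\<^bsub>?F\<^esub> s v \<oplus>\<^bsub>?F\<^esub> c \<odot>\<^bsub>?F\<^esub> s w = s (a \<odot>\<^bsub>P\<^esub> u \<oplus>\<^bsub>P\<^esub> b \<odot>\<^bsub>P\<^esub> v \<oplus>\<^bsub>P\<^esub> c \<odot>\<^bsub>P\<^esub> w)"
    using abc uvw by (simp add: mod_homD[OF s])
  also have "\<dots> = \<zero>\<^bsub>?F\<^esub>" using rel mod_hom_zero[OF P' F s] by simp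
  finally have "a \<otimes>\<^bsub>R\<^esub> s u i \<oplus>\<^bsub>R\<^esub> b \<otimes>\<^bsub>R\<^esub> s v i \<oplus>\<^bsub>R\<^esub> c \<otimes>\<^bsub>R\<^esub> s w i = \<zero>\<^bsub>R\<^esub>" for i
    by (metis app)
  then have "\<forall>i. \<exists>y\<in>carrier R. \<exists>z\<in>carrier R. s u i = b \<otimes>\<^bsub>R\<^esub> y \<oplus>\<^bsub>R\<^esub> c \<otimes>\<^bsub>R\<^esub> z"
    using ring sr uvw by blast
  then obtain Y Z where YZ: "\<And>i. Y i \<in> carrier R" "\<And>i. Z i \<in> carrier R"
    "\<And>i. s u i = b \<otimes>\<^bsub>R\<^esub> Y i \<oplus>\<^bsub>R\<^esub> c \<otimes>\<^bsub>R\<^esub> Z i"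
    by metis
  \<comment> \<open>Coordinates in which \<open>s u\<close> vanishes get the coefficients \<open>0\<close>, which keeps the supports finite.\<close>
  let ?cut = "\<lambda>f i. if s u i = \<zero>\<^bsub>R\<^esub> then \<zero>\<^bsub>R\<^esub> else f i"
  have cut: "?cut f \<in> carrier ?F" if "\<And>i. f i \<in> carrier R" for f
  proof -
    have "finite {i. ?cut f i \<noteq> \<zero>\<^bsub>R\<^esub>}"
      by (rule rev_finite_subset[of "{i. s u i \<noteq> \<zero>\<^bsub>R\<^esub>}"])
        (use sc[OF uvw(1)] in \<open>auto simp: free_carrier_def\<close>)
    then show ?thesis using that sc[OF uvw(1)] by (auto simp: Fc free_carrier_def)
  qed
  have "s u = b \<odot>\<^bsub>?F\<^esub> ?cut Y \<oplus>\<^bsub>?F\<^esub> c \<odot>\<^bsub>?F\<^esub> ?cut Z"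
    using YZ abc by (auto simp: fun_eq_iff app)
  then obtain y z where yz: "y \<in> carrier ?F" "z \<in> carrier ?F"
    and su: "s u = b \<odot>\<^bsub>?F\<^esub> y \<oplus>\<^bsub>?F\<^esub> c \<odot>\<^bsub>?F\<^esub> z"
    using cut[of Y] cut[of Z] YZ by blast
  have "u = ?p (s u)" using ps uvw by simp
  also have "\<dots> = b \<odot>\<^bsub>P\<^esub> ?p y \<oplus>\<^bsub>P\<^esub> c \<odot>\<^bsub>P\<^esub> ?p z"
    using yz abc by (simp add: su mod_homD[OF p])
  finally show ?thesis using mod_homD(1)[OF p] yz by blast
qed

text \<open>
  Applied to the images of the three pairwise syzygies of a triple of monomials, whose coefficients
  at each of the three basis elements cancel.
\<close>
lemma smult_cycle:
  assumes "module R A" and xyz: "x \<in> carrier A" "y \<in> carrier A" "z \<in> carrier A"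
    and r: "r1 \<in> carrier R" "r2 \<in> carrier R" "r3 \<in> carrier R"
    and s: "s1 \<in> carrier R" "s2 \<in> carrier R" "s3 \<in> carrier R"
    and sums: "r1 \<oplus>\<^bsub>R\<^esub> s3 = \<zero>\<^bsub>R\<^esub>" "r2 \<oplus>\<^bsub>R\<^esub> s1 = \<zero>\<^bsub>R\<^esub>" "r3 \<oplus>\<^bsub>R\<^esub> s2 = \<zero>\<^bsub>R\<^esub>"
  shows "(r1 \<odot>\<^bsub>A\<^esub> x \<oplus>\<^bsub>A\<^esub> s1 \<odot>\<^bsub>A\<^esub> y) \<oplus>\<^bsub>A\<^esub> (r2 \<odot>\<^bsub>A\<^esub> y \<oplus>\<^bsub>A\<^esub> s2 \<odot>\<^bsub>A\<^esub> z) \<oplus>\<^bsub>A\<^esub> (r3 \<odot>\<^bsub>A\<^esub> z \<oplus>\<^bsub>A\<^esub> s3 \<odot>\<^bsub>A\<^esub> x) = \<zero>\<^bsub>A\<^esub>"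
proof -
  interpret module R A by fact
  have "(r1 \<odot>\<^bsub>A\<^esub> x \<oplus>\<^bsub>A\<^esub> s1 \<odot>\<^bsub>A\<^esub> y) \<oplus>\<^bsub>A\<^esub> (r2 \<odot>\<^bsub>A\<^esub> y \<oplus>\<^bsub>A\<^esub> s2 \<odot>\<^bsub>A\<^esub> z) \<oplus>\<^bsub>A\<^esub> (r3 \<odot>\<^bsub>A\<^esub> z \<oplus>\<^bsub>A\<^esub> s3 \<odot>\<^bsub>A\<^esub> x) =
      (r1 \<odot>\<^bsub>A\<^esub> x \<oplus>\<^bsub>A\<^esub> s3 \<odot>\<^bsub>A\<^esub> x) \<oplus>\<^bsub>A\<^esub> ((r2 \<odot>\<^bsub>A\<^esub> y \<oplus>\<^bsub>A\<^esub> s1 \<odot>\<^bsub>A\<^esub> y) \<oplus>\<^bsub>A\<^esub> (r3 \<odot>\<^bsub>A\<^esub> z \<oplus>\<^bsub>A\<^esub> s2 \<odot>\<^bsub>A\<^esub> z))"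
    using xyz r s by (simp add: M.a_ac)
  also have "\<dots> = (r1 \<oplus>\<^bsub>R\<^esub> s3) \<odot>\<^bsub>A\<^esub> x \<oplus>\<^bsub>A\<^esub> ((r2 \<oplus>\<^bsub>R\<^esub> s1) \<odot>\<^bsub>A\<^esub> y \<oplus>\<^bsub>A\<^esub> (r3 \<oplus>\<^bsub>R\<^esub> s2) \<odot>\<^bsub>A\<^esub> z)"
    using xyz r s by (simp add: smult_l_distr)
  also have "\<dots> = \<zero>\<^bsub>A\<^esub>" using xyz by (simp add: sums)
  finally show ?thesis .
qed

lemma mod_hom_kernel_image:
  assumes "\<delta> ` carrier A = a_kernel B C h" "h x = \<zero>\<^bsub>C\<^esub>" "x \<in> carrier B"
  shows "\<exists>y\<in>carrier A. \<delta> y = x"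
proof -
  have "x \<in> a_kernel B C h" using assms by (simp add: a_kernel_def kernel_def)
  then show ?thesis using assms(1) by (metis imageE)
qed

definition ideal_module :: "('a, 'r) ring_scheme \<Rightarrow> 'a set \<Rightarrow> ('a, 'a) module"
  where "ideal_module R I = \<lparr>carrier = I, monoid.mult = monoid.mult R, one = \<one>\<^bsub>R\<^esub>,
    zero = \<zero>\<^bsub>R\<^esub>, add = add R, module.smult = monoid.mult R\<rparr>"

lemma ideal_module_simps [simp]:
  "carrier (ideal_module R I) = I" "\<zero>\<^bsub>ideal_module R I\<^esub> = \<zero>\<^bsub>R\<^esub>"
  "x \<oplus>\<^bsub>ideal_module R I\<^esub> y = x \<oplus>\<^bsub>R\<^esub> y" "r \<odot>\<^bsub>ideal_module R I\<^esub> x = r \<otimes>\<^bsub>R\<^esub> x"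
  by (simp_all add: ideal_module_def)

lemma module_ideal_module:
  assumes "cring R" "ideal I R"
  shows "module R (ideal_module R I)"
proof -
  interpret cring R by fact
  interpret I: ideal I R by fact
  have sub: "x \<in> carrier R" if "x \<in> I" for x using I.a_subset that by blast
  have "abelian_group (ideal_module R I)"
  proof (intro abelian_groupI)
    fix x assume "x \<in> carrier (ideal_module R I)"
    then show "\<exists>y\<in>carrier (ideal_module R I). y \<oplus>\<^bsub>ideal_module R I\<^esub> x = \<zero>\<^bsub>ideal_module R I\<^esub>"
      by (intro bexI[of _ "\<ominus>\<^bsub>R\<^esub> x"]) (auto simp: sub l_neg)
  qed (auto simp: sub a_ac)
  then show ?thesis
    by (intro moduleI assms) (auto simp: sub l_distr r_distr m_assoc I.I_l_closed)
qed

lemma quotient_map: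
  assumes "cring R" "ideal I R"
  shows "(+>\<^bsub>R\<^esub>) I \<in> mod_hom R (ideal_module R (carrier R)) (quotient_module R I)"
    and "((+>\<^bsub>R\<^esub>) I) ` carrier R = carrier (quotient_module R I)"
    and "x \<in> carrier R \<Longrightarrow> I +>\<^bsub>R\<^esub> x = \<zero>\<^bsub>quotient_module R I\<^esub> \<longleftrightarrow> x \<in> I"
proof -
  interpret cring R by fact
  interpret I: ideal I R by fact
  have h: "(+>\<^bsub>R\<^esub>) I \<in> ring_hom R (R Quot I)" by (rule I.rcos_ring_hom)
  note hs = ring_hom_closed[OF h] ring_hom_mult[OF h] ring_hom_add[OF h]
  let ?M = "quotient_module R I"
  have M: "carrier ?M = carrier (R Quot I)" "add ?M = add (R Quot I)" "zero ?M = I"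
    "module.smult ?M = (\<lambda>r c. (I +>\<^bsub>R\<^esub> r) \<otimes>\<^bsub>R Quot I\<^esub> c)"
    by (simp_all add: quotient_module_def ring.extend_def module.fields_def FactRing_def)
  show "(+>\<^bsub>R\<^esub>) I \<in> mod_hom R (ideal_module R (carrier R)) ?M"
    by (auto simp: mod_hom_def M hs)
  show "((+>\<^bsub>R\<^esub>) I) ` carrier R = carrier ?M"
    by (auto simp: M FactRing_def A_RCOSETS_def' )
  show "x \<in> carrier R \<Longrightarrow> I +>\<^bsub>R\<^esub> x = zero ?M \<longleftrightarrow> x \<in> I"
    using I.rcos_const_imp_mem a_rcos_zero[OF assms(2)] by (auto simp: M)
qed

text \<open>
  A set of extended naturals contains its infimum unless it is empty, and the infimum is finite
  only if it is not empty.
\<close>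
lemma proj_dim_eq_enat_iff:
  fixes R :: "('a, 'r) ring_scheme" and N :: "('a, 'b) module"
  defines "D \<equiv> {d. \<exists>(P :: nat \<Rightarrow> ('a, nat \<times> 'b \<Rightarrow> 'a) module) \<delta> \<epsilon>.
    projective_resolution R N P \<delta> \<epsilon> \<and> (\<forall>i>d. carrier (P i) = {\<zero>\<^bsub>P i\<^esub>})}"
  shows "proj_dim R N = enat d \<longleftrightarrow> d \<in> D \<and> (\<forall>d'\<in>D. d \<le> d')"
proof -
  have pd: "proj_dim R N = Inf (enat ` D)"
    unfolding proj_dim_def D_def by (rule arg_cong[where f = Inf]) auto
  show ?thesis
  proof
    assume eq: "proj_dim R N = enat d"
    then have "enat ` D \<noteq> {}" unfolding pd by (auto simp: Inf_enat_def)
    then have "Inf (enat ` D) \<in> enat ` D" by (auto simp: Inf_enat_def intro: LeastI)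
    then have "d \<in> D" using eq pd by auto
    moreover have "d \<le> d'" if "d' \<in> D" for d'
      using Inf_lower[of "enat d'" "enat ` D"] that eq pd by auto
    ultimately show "d \<in> D \<and> (\<forall>d'\<in>D. d \<le> d')" by blast
  next
    assume "d \<in> D \<and> (\<forall>d'\<in>D. d \<le> d')"
    then show "proj_dim R N = enat d"
      unfolding pd by (intro antisym Inf_lower Inf_greatest) auto
  qed
qed

section \<open>Monomial ideals and their syzygies\<close>

lemma ring_of_type_algebra_simps [simp]:
  "carrier (ring_of_type_algebra :: 'a :: comm_ring_1 ring) = UNIV"
  "x \<otimes>\<^bsub>ring_of_type_algebra\<^esub> y = x * (y :: 'a)"
  "x \<oplus>\<^bsub>ring_of_type_algebra\<^esub> y = x + (y :: 'a)"
  "\<zero>\<^bsub>ring_of_type_algebra\<^esub> = (0 :: 'a)" "\<one>\<^bsub>ring_of_type_algebra\<^esub> = (1 :: 'a)"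
  by (simp_all add: ring_of_type_algebra_def)

lemma free_module_mpoly_simps:
  fixes J :: "'u set"
  assumes "finite J"
  shows "carrier (free_module (mpoly_ring :: ('x, 'k :: field) mpoly ring) J) = {f. \<forall>x. x \<notin> J \<longrightarrow> f x = 0}"
proof -
  have "finite {x. f x \<noteq> 0}" if "\<forall>x. x \<notin> J \<longrightarrow> f x = 0" for f :: "'u \<Rightarrow> ('x, 'k) mpoly"
    by (rule rev_finite_subset[OF assms]) (use that in auto)
  then show ?thesis by (auto simp: free_module_def free_carrier_def)
qed

lemma free_module_ops [simp]:
  "f \<oplus>\<^bsub>free_module R J\<^esub> g = (\<lambda>x. f x \<oplus>\<^bsub>R\<^esub> g x)" "r \<odot>\<^bsub>free_module R J\<^esub> f = (\<lambda>x. r \<otimes>\<^bsub>R\<^esub> f x)"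
  "\<zero>\<^bsub>free_module R J\<^esub> = (\<lambda>x. \<zero>\<^bsub>R\<^esub>)"
  by (simp_all add: free_module_def)

definition monomial_comb ::
  "'i set \<Rightarrow> ('i \<Rightarrow> 'x \<Rightarrow>\<^sub>0 nat) \<Rightarrow> ('i \<Rightarrow> ('x, 'k :: field) mpoly) \<Rightarrow> ('x, 'k) mpoly"
  where "monomial_comb I g f = (\<Sum>i\<in>I. f i * monomial (g i))"

lemma monomial_comb_add:
  "monomial_comb I g (\<lambda>i. f i + f' i) = monomial_comb I g f + monomial_comb I g f'"
  by (simp add: monomial_comb_def distrib_right sum.distrib)

lemma monomial_comb_mult:
  "monomial_comb I g (\<lambda>i. r * f i) = r * monomial_comb I g f"
  by (simp add: monomial_comb_def sum_distrib_left mult.assoc)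

lemma monomial_comb_diff:
  "monomial_comb I g (\<lambda>i. f i - f' i) = monomial_comb I g f - monomial_comb I g f'"
  by (simp add: monomial_comb_def left_diff_distrib sum_subtractf)

lemma monomial_comb_unit:
  assumes "finite I" "i \<in> I"
  shows "monomial_comb I g (\<lambda>k. if k = i then 1 else 0) = monomial (g i)"
  using assms by (simp add: monomial_comb_def if_distrib[of "\<lambda>x. x * _"] cong: if_cong)

lemma ideal_range_monomial_comb:
  "ideal (range (monomial_comb I g)) (mpoly_ring :: ('x, 'k :: field) mpoly ring)"
proof -
  interpret cring "mpoly_ring :: ('x, 'k) mpoly ring" by (rule cring_from_type_algebra)
  let ?M = "range (monomial_comb I g) :: ('x, 'k) mpoly set"
  have add: "p + q \<in> ?M" if "p \<in> ?M" "q \<in> ?M" for p q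
    using that by (auto simp: monomial_comb_add[symmetric])
  have mult: "r * p \<in> ?M" if "p \<in> ?M" for r p
    using that by (auto simp: monomial_comb_mult[symmetric])
  have "subgroup ?M (add_monoid (mpoly_ring :: ('x, 'k) mpoly ring))"
  proof (rule group.subgroupI[OF add.is_group])
    fix p assume p: "p \<in> ?M"
    have "inv\<^bsub>add_monoid mpoly_ring\<^esub> p = - 1 * p"
      by (rule group.inv_equality[OF add.is_group]) auto
    then show "inv\<^bsub>add_monoid mpoly_ring\<^esub> p \<in> ?M" using mult[OF p, of "-1"] by simp
  qed (auto intro: add[simplified])
  then show ?thesis
    using mult by (intro idealI ring_from_type_algebra) (auto simp: mult.commute)
qed

text \<open>
  The combinations form an ideal that contains the generators, and every ideal with this property
  contains the combinations.
\<close>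
lemma genideal_monomials:
  assumes "finite I"
  shows "Idl\<^bsub>mpoly_ring\<^esub> (monomial ` g ` I :: ('x, 'k :: field) mpoly set) = range (monomial_comb I g)"
proof (rule antisym)
  interpret cring "mpoly_ring :: ('x, 'k) mpoly ring" by (rule cring_from_type_algebra)
  have "monomial (g i) \<in> range (monomial_comb I g)" if "i \<in> I" for i
    using monomial_comb_unit[OF assms that, of g] by (metis rangeI)
  then show "Idl\<^bsub>mpoly_ring\<^esub> (monomial ` g ` I :: ('x, 'k) mpoly set) \<subseteq> range (monomial_comb I g)"
    by (intro genideal_minimal ideal_range_monomial_comb) auto
  let ?J = "Idl\<^bsub>mpoly_ring\<^esub> (monomial ` g ` I :: ('x, 'k) mpoly set)"
  have J: "ideal ?J mpoly_ring" by (rule genideal_ideal) simp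
  interpret J: ideal ?J "mpoly_ring :: ('x, 'k) mpoly ring" by (rule J)
  have gen: "monomial (g i) \<in> ?J" if "i \<in> I" for i
    using that genideal_self[of "monomial ` g ` I :: ('x, 'k) mpoly set"] by auto
  have sum: "(\<Sum>k\<in>A. f k * monomial (g k)) \<in> ?J" if "finite A" "A \<subseteq> I"
    for A and f :: "'a \<Rightarrow> ('x, 'k) mpoly"
    using that
  proof (induction A rule: finite_induct)
    case empty
    show ?case using J.zero_closed by simp
  next
    case (insert i A)
    have "f i * monomial (g i) \<in> ?J" using J.I_l_closed[of "monomial (g i)" "f i"] insert gen by simp
    then show ?case using J.a_closed insert by simp
  qed
  have "monomial_comb I g f \<in> ?J" for f :: "'a \<Rightarrow> ('x, 'k) mpoly"
    unfolding monomial_comb_def by (rule sum[OF assms order_refl])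
  then show "range (monomial_comb I g) \<subseteq> ?J" by auto
qed

lemma monomial_comb_hom:
  fixes g :: "'i \<Rightarrow> 'x \<Rightarrow>\<^sub>0 nat" and M :: "('x, 'k :: field) mpoly set"
  assumes "finite I" and M: "M = range (monomial_comb I g)"
  shows "monomial_comb I g \<in> mod_hom mpoly_ring (free_module mpoly_ring I) (ideal_module mpoly_ring M)"
    and "monomial_comb I g ` carrier (free_module mpoly_ring I) = M"
proof -
  show "monomial_comb I g \<in> mod_hom mpoly_ring (free_module mpoly_ring I) (ideal_module mpoly_ring M)"
    by (auto simp: mod_hom_def free_module_def M monomial_comb_add monomial_comb_mult)
  have "monomial_comb I g f \<in> monomial_comb I g ` carrier (free_module mpoly_ring I)"
    for f :: "'i \<Rightarrow> ('x, 'k) mpoly"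
  proof
    let ?f = "\<lambda>i. if i \<in> I then f i else 0"
    show "monomial_comb I g f = monomial_comb I g ?f" by (simp add: monomial_comb_def)
    have "finite {i. ?f i \<noteq> 0}" by (rule rev_finite_subset[OF assms(1)]) auto
    then show "?f \<in> carrier (free_module mpoly_ring I)"
      by (auto simp: free_module_def free_carrier_def)
  qed
  then show "monomial_comb I g ` carrier (free_module mpoly_ring I) = M" by (auto simp: M)
qed

text \<open>
  The term \<open>t\<close> of \<open>f i\<close> gives a term of \<open>f i * monomial (g i)\<close>, which cancels only against
  a term of some other summand.
\<close>
lemma syzygy_term:
  fixes f :: "'i \<Rightarrow> ('x, 'k :: field) mpoly"
  assumes "finite I" "i \<in> I" and syz: "(\<Sum>j\<in>I. f j * monomial (g j)) = 0"
    and t: "t \<in> Poly_Mapping.keys (f i)"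
  obtains j where "j \<in> I - {i}" "g j \<preceq> g i + t"
proof -
  have "monomial (g i) * f i = (\<Sum>j\<in>I-{i}. - (monomial (g j) * f j))"
    using assms(1,2) syz by (simp add: sum.remove sum_negf mult.commute eq_neg_iff_add_eq_0)
  moreover have "g i + t \<in> Poly_Mapping.keys (monomial (g i) * f i)"
    using t by (simp add: keys_monomial_mult)
  ultimately obtain j where "j \<in> I - {i}" "g i + t \<in> Poly_Mapping.keys (monomial (g j) * f j)"
    using keys_sum_subset[of "\<lambda>j. - (monomial (g j) * f j)" "I - {i}"] by auto
  then obtain s where "g i + t = g j + s" by (auto simp: keys_monomial_mult)
  then have "g j \<preceq> g i + t" using exp_le_add[of "g j" s] by simp
  with \<open>j \<in> I - {i}\<close> show ?thesis by (rule that)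
qed

text \<open>
  The \<open>i\<close>-th coefficient \<open>L/g i\<close> of a syzygy of multidegree \<open>L\<close> is a monomial, so it occurs
  in \<open>b z'\<close> or in \<open>a z\<close>. The first means that \<open>b\<close> divides \<open>L/g i\<close>. The second
  gives a term of \<open>z\<close> of multidegree \<open>L/a\<close>, and since \<open>z\<close> is a syzygy, another generator divides
  \<open>L/a\<close> as well.
\<close>
lemma no_syzygy_factor:
  fixes g :: "'i \<Rightarrow> 'x \<Rightarrow>\<^sub>0 nat" and z z' :: "'i \<Rightarrow> ('x, 'k :: field) mpoly"
  assumes "finite I" "i \<in> I" "g i \<preceq> L"
    and z: "monomial_comb I g z = 0"
    and eq: "monomial a * z i + monomial b * z' i = monomial (L - g i)"
    and a: "\<And>k. k \<in> I - {i} \<Longrightarrow> \<not> g k + a \<preceq> L"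
    and b: "\<not> g i + b \<preceq> L"
  shows False
proof -
  have L: "g i + (L - g i) = L" by (rule exp_add_diff) fact
  have "L - g i \<in> Poly_Mapping.keys (monomial a * z i + monomial b * z' i)"
    unfolding eq by (simp add: monomial_def)
  then consider t where "L - g i = a + t" "t \<in> Poly_Mapping.keys (z i)" | t where "L - g i = b + t"
    using Poly_Mapping.keys_add[of "monomial a * z i" "monomial b * z' i"]
    by (auto simp: keys_monomial_mult)
  then show False
  proof cases
    case (1 t)
    obtain k where k: "k \<in> I - {i}" "g k \<preceq> g i + t"
      using syzygy_term[OF assms(1,2) z[unfolded monomial_comb_def] 1(2)] by blast
    have "L = g i + t + a" using L 1(1) by (simp add: ac_simps)
    then have "g k + a \<preceq> L" using k(2) by (simp add: lookup_add)
    with a k(1) show False by blast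
  next
    case (2 t)
    then have "L = g i + b + t" using L by (simp add: ac_simps)
    with b show False using exp_le_add[of "g i + b" t] by simp
  qed
qed

section \<open>Lifting syzygies to a projective resolution\<close>

text \<open>
  The elements \<open>p i\<close> of the term \<open>P 1\<close> of a resolution of \<open>S/M\<close> play the role of the basis
  elements \<open>e i\<close> of the free module that maps onto \<open>M\<close>. The second conjunct lifts the syzygy
  \<open>a e i + b e j\<close> to \<open>P 2\<close>. The third one transports decompositions of such a lift
  back: if the lift has the form \<open>a u + b v\<close> and \<open>a\<close> and \<open>b\<close> divide the two coefficients of the
  syzygy, then the syzygy is \<open>a z + b z'\<close> for two syzygies \<open>z\<close> and \<open>z'\<close>.
\<close>
definition syzygy_lift ::
  "'i set \<Rightarrow> ('i \<Rightarrow> 'x \<Rightarrow>\<^sub>0 nat) \<Rightarrow> (nat \<Rightarrow> (('x, 'k :: field) mpoly, 'u) module) \<Rightarrow>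
    (nat \<Rightarrow> 'u \<Rightarrow> 'u) \<Rightarrow> ('i \<Rightarrow> 'u) \<Rightarrow> bool"
  where "syzygy_lift I g P \<delta> p \<longleftrightarrow>
    (\<forall>i\<in>I. p i \<in> carrier (P 1)) \<and>
    (\<forall>i\<in>I. \<forall>j\<in>I. \<forall>a b. a * monomial (g i) + b * monomial (g j) = 0 \<longrightarrow>
      (\<exists>y\<in>carrier (P 2). \<delta> 1 y = a \<odot>\<^bsub>P 1\<^esub> p i \<oplus>\<^bsub>P 1\<^esub> b \<odot>\<^bsub>P 1\<^esub> p j)) \<and>
    (\<forall>i\<in>I. \<forall>j\<in>I. \<forall>u\<in>carrier (P 2). \<forall>v\<in>carrier (P 2). \<forall>a b r s.
      a * r * monomial (g i) + b * s * monomial (g j) = 0 \<longrightarrow>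
      \<delta> 1 (a \<odot>\<^bsub>P 2\<^esub> u \<oplus>\<^bsub>P 2\<^esub> b \<odot>\<^bsub>P 2\<^esub> v) = (a * r) \<odot>\<^bsub>P 1\<^esub> p i \<oplus>\<^bsub>P 1\<^esub> (b * s) \<odot>\<^bsub>P 1\<^esub> p j \<longrightarrow>
      (\<exists>z z'. monomial_comb I g z = 0 \<and> monomial_comb I g z' = 0 \<and>
        (\<forall>k\<in>I. a * z k + b * z' k = (if k = i then a * r else 0) + (if k = j then b * s else 0))))"

lemma syzygy_liftD:
  assumes "syzygy_lift I g P \<delta> p"
  shows "i \<in> I \<Longrightarrow> p i \<in> carrier (P 1)"
    and "i \<in> I \<Longrightarrow> j \<in> I \<Longrightarrow> a * monomial (g i) + b * monomial (g j) = 0 \<Longrightarrow>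
      \<exists>y\<in>carrier (P 2). \<delta> 1 y = a \<odot>\<^bsub>P 1\<^esub> p i \<oplus>\<^bsub>P 1\<^esub> b \<odot>\<^bsub>P 1\<^esub> p j"
    and "i \<in> I \<Longrightarrow> j \<in> I \<Longrightarrow> u \<in> carrier (P 2) \<Longrightarrow> v \<in> carrier (P 2) \<Longrightarrow>
      a * r * monomial (g i) + b * s * monomial (g j) = 0 \<Longrightarrow>
      \<delta> 1 (a \<odot>\<^bsub>P 2\<^esub> u \<oplus>\<^bsub>P 2\<^esub> b \<odot>\<^bsub>P 2\<^esub> v) = (a * r) \<odot>\<^bsub>P 1\<^esub> p i \<oplus>\<^bsub>P 1\<^esub> (b * s) \<odot>\<^bsub>P 1\<^esub> p j \<Longrightarrow>
      \<exists>z z'. monomial_comb I g z = 0 \<and> monomial_comb I g z' = 0 \<and>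
        (\<forall>k\<in>I. a * z k + b * z' k = (if k = i then a * r else 0) + (if k = j then b * s else 0))"
  using assms unfolding syzygy_lift_def by blast+

text \<open>
  Exactness provides the \<open>p i\<close> and the lifts of syzygies. For the third property, projectivity
  of \<open>P 0\<close> and \<open>P 1\<close> provides maps \<open>\<beta> : P 0 \<rightarrow> S\<close> and \<open>\<gamma> : P 1 \<rightarrow> S^I\<close> over the
  identity of \<open>S/M\<close>. Since \<open>\<beta>\<close> is only determined modulo \<open>M\<close>, the map \<open>\<gamma>\<close> sends \<open>p i\<close> not to
  \<open>e i\<close> but to \<open>e i + g i f0 + \<zeta> i\<close> with a vector \<open>f0\<close> that does not depend on \<open>i\<close> and a syzygy
  \<open>\<zeta> i\<close>. In a syzygy \<open>a r e i + b s e j\<close> the contributions of \<open>f0\<close> cancel, and those of \<open>\<zeta> i\<close> and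
  \<open>\<zeta> j\<close> have the coefficients \<open>a r\<close> and \<open>b s\<close>, so that they are absorbed by \<open>z\<close> and \<open>z'\<close>.
\<close>
lemma syzygy_lift_exists:
  fixes g :: "'i \<Rightarrow> 'x \<Rightarrow>\<^sub>0 nat" and M :: "('x, 'k :: field) mpoly set"
    and P :: "nat \<Rightarrow> (('x, 'k) mpoly, 'u) module"
  assumes fin: "finite I" and M: "M = range (monomial_comb I g)"
    and res: "projective_resolution mpoly_ring (quotient_module mpoly_ring M) P \<delta> \<epsilon>"
  shows "\<exists>p. syzygy_lift I g P \<delta> p"
proof -
  note One_nat_def [simp del]
  let ?R = "mpoly_ring :: ('x, 'k) mpoly ring"
  let ?N = "quotient_module ?R M" and ?S = "ideal_module ?R UNIV" and ?\<pi> = "(+>\<^bsub>?R\<^esub>) M"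
  have R: "cring ?R" by (rule cring_from_type_algebra)
  have IM: "ideal M ?R" unfolding M by (rule ideal_range_monomial_comb)
  have "ideal UNIV ?R" using ring.oneideal[of ?R] R by (simp add: cring_def)
  then have S: "module ?R ?S" by (rule module_ideal_module[OF R])
  have N: "module ?R ?N" by (rule module_quotient_module[OF R IM])
  have MM: "module ?R (ideal_module ?R M)" by (rule module_ideal_module[OF R IM])
  have F: "module ?R (free_module ?R I)" by (rule module_free_module[OF R])
  note pi = quotient_map[OF R IM, simplified]
  have proj: "projective_module ?R (P i)" for i using res by (simp add: projective_resolution_def)
  then have P: "module ?R (P i)" for i by (simp add: projective_module_def)
  interpret P0: module ?R "P 0" by (rule P)
  interpret P1: module ?R "P 1" by (rule P)
  interpret P2: module ?R "P 2" by (rule P)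
  interpret N: module ?R ?N by (rule N)
  have eps: "\<epsilon> \<in> mod_hom ?R (P 0) ?N" "\<epsilon> ` carrier (P 0) = carrier ?N"
    and d0: "\<delta> 0 \<in> mod_hom ?R (P 1) (P 0)" and d1: "\<delta> 1 \<in> mod_hom ?R (P 2) (P 1)"
    and ex0: "\<delta> 0 ` carrier (P 1) = a_kernel (P 0) ?N \<epsilon>"
    and ex1: "\<delta> 1 ` carrier (P 2) = a_kernel (P 1) (P 0) (\<delta> 0)"
    using res by (auto simp: projective_resolution_def numeral_2_eq_2 One_nat_def)
  have \<epsilon>\<delta>: "\<epsilon> (\<delta> 0 x) = \<zero>\<^bsub>?N\<^esub>" if "x \<in> carrier (P 1)" for x
    using ex0 that by (auto simp: a_kernel_def kernel_def)
  have \<delta>\<delta>: "\<delta> 0 (\<delta> 1 x) = \<zero>\<^bsub>P 0\<^esub>" if "x \<in> carrier (P 2)" for x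
    using ex1 that by (auto simp: a_kernel_def kernel_def)

  obtain \<beta> where \<beta>: "\<beta> \<in> mod_hom ?R (P 0) ?S" and \<pi>\<beta>: "\<And>x. x \<in> carrier (P 0) \<Longrightarrow> ?\<pi> (\<beta> x) = \<epsilon> x"
    using projective_module_lift[OF proj[of 0] S N pi(1) _ eps(1)] pi(2) by auto
  have "?\<pi> 1 \<in> \<epsilon> ` carrier (P 0)" using eps(2) pi(2) by auto
  then obtain p0 where p0: "p0 \<in> carrier (P 0)" "\<epsilon> p0 = ?\<pi> 1" by auto
  have "?\<pi> (\<beta> p0 - 1) = \<zero>\<^bsub>?N\<^esub>"
  proof -
    have "?\<pi> (\<beta> p0 + (-1) * 1) = ?\<pi> 1 \<oplus>\<^bsub>?N\<^esub> (-1) \<odot>\<^bsub>?N\<^esub> ?\<pi> 1"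
      using mod_homD(2)[OF pi(1), of "\<beta> p0" "(-1) * 1"] mod_homD(3)[OF pi(1), of "-1" 1] \<pi>\<beta> p0
      by simp
    also have "\<dots> = ?\<pi> (1 + (-1) * 1)"
      using mod_homD(2)[OF pi(1), of 1 "(-1) * 1"] mod_homD(3)[OF pi(1), of "-1" 1] by simp
    also have "\<dots> = \<zero>\<^bsub>?N\<^esub>" using mod_hom_zero[OF S N pi(1)] by simp
    finally show ?thesis by simp
  qed
  then have "\<beta> p0 - 1 \<in> M" using pi(3) by simp
  then obtain f0 where f0: "\<beta> p0 = 1 + monomial_comb I g f0" unfolding M by (auto simp: algebra_simps)

  have "\<exists>x\<in>carrier (P 1). \<delta> 0 x = monomial (g i) \<odot>\<^bsub>P 0\<^esub> p0" if i: "i \<in> I" for i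
  proof (rule mod_hom_kernel_image[OF ex0])
    have "monomial (g i) \<in> M" unfolding M using monomial_comb_unit[OF fin i, of g] by (metis rangeI)
    have "\<epsilon> (monomial (g i) \<odot>\<^bsub>P 0\<^esub> p0) = ?\<pi> (monomial (g i) * 1)"
      using mod_homD(3)[OF eps(1)] mod_homD(3)[OF pi(1), of "monomial (g i)" 1] p0 by simp
    also have "\<dots> = \<zero>\<^bsub>?N\<^esub>" using pi(3) \<open>monomial (g i) \<in> M\<close> by simp
    finally show "\<epsilon> (monomial (g i) \<odot>\<^bsub>P 0\<^esub> p0) = \<zero>\<^bsub>?N\<^esub>" .
  qed (use p0 in simp)
  then obtain p where p: "\<And>i. i \<in> I \<Longrightarrow> p i \<in> carrier (P 1)"
    and dp: "\<And>i. i \<in> I \<Longrightarrow> \<delta> 0 (p i) = monomial (g i) \<odot>\<^bsub>P 0\<^esub> p0"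
    by metis

  have "\<beta> (\<delta> 0 x) \<in> M" if "x \<in> carrier (P 1)" for x
    using \<epsilon>\<delta>[OF that] \<pi>\<beta>[OF mod_homD(1)[OF d0 that]] pi(3)[of "\<beta> (\<delta> 0 x)"] by simp
  then have \<beta>\<delta>: "(\<lambda>x. \<beta> (\<delta> 0 x)) \<in> mod_hom ?R (P 1) (ideal_module ?R M)"
    using mod_hom_comp[OF d0 \<beta>] by (auto simp: mod_hom_def)
  obtain \<gamma> where \<gamma>: "\<gamma> \<in> mod_hom ?R (P 1) (free_module ?R I)"
    and \<phi>\<gamma>: "\<And>x. x \<in> carrier (P 1) \<Longrightarrow> monomial_comb I g (\<gamma> x) = \<beta> (\<delta> 0 x)"
    using projective_module_lift[OF proj[of 1] F MM monomial_comb_hom(1)[OF fin M] _ \<beta>\<delta>]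
      monomial_comb_hom(2)[OF fin M] by auto
  define \<zeta> where "\<zeta> i k = \<gamma> (p i) k - ((if k = i then 1 else 0) + monomial (g i) * f0 k)" for i k
  have \<zeta>: "monomial_comb I g (\<zeta> i) = 0" if i: "i \<in> I" for i
  proof -
    have "monomial_comb I g (\<gamma> (p i)) = \<beta> (monomial (g i) \<odot>\<^bsub>P 0\<^esub> p0)" using \<phi>\<gamma> p dp i by simp
    also have "\<dots> = monomial (g i) * (1 + monomial_comb I g f0)"
      using mod_homD(3)[OF \<beta>, of "monomial (g i)" p0] p0 f0 by simp
    finally show ?thesis
      unfolding \<zeta>_def monomial_comb_diff monomial_comb_add monomial_comb_mult monomial_comb_unit[OF fin i]
      by (simp add: algebra_simps)
  qed
  have \<gamma>\<delta>: "monomial_comb I g (\<gamma> (\<delta> 1 x)) = 0" if x: "x \<in> carrier (P 2)" for x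
    using \<phi>\<gamma>[OF mod_homD(1)[OF d1 x]] \<delta>\<delta>[OF x] mod_hom_zero[OF P S \<beta>] by simp
  have \<gamma>lin: "\<gamma> (a \<odot>\<^bsub>P 1\<^esub> x \<oplus>\<^bsub>P 1\<^esub> b \<odot>\<^bsub>P 1\<^esub> y) k = a * \<gamma> x k + b * \<gamma> y k"
    if "x \<in> carrier (P 1)" "y \<in> carrier (P 1)" for a b x y k
    using that by (simp add: mod_homD[OF \<gamma>])

  show ?thesis
    unfolding syzygy_lift_def
  proof (intro exI[of _ p] conjI ballI allI impI p)
    fix i j and a b :: "('x, 'k) mpoly" assume ij: "i \<in> I" "j \<in> I" and ab: "a * monomial (g i) + b * monomial (g j) = 0"
    have "\<delta> 0 (a \<odot>\<^bsub>P 1\<^esub> p i \<oplus>\<^bsub>P 1\<^esub> b \<odot>\<^bsub>P 1\<^esub> p j) = (a * monomial (g i) + b * monomial (g j)) \<odot>\<^bsub>P 0\<^esub> p0"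
      using ij p p0 dp P0.smult_l_distr[of "a * monomial (g i)" "b * monomial (g j)" p0]
        P0.smult_assoc1[of a "monomial (g i)" p0] P0.smult_assoc1[of b "monomial (g j)" p0]
      by (simp add: mod_homD[OF d0])
    then have "\<delta> 0 (a \<odot>\<^bsub>P 1\<^esub> p i \<oplus>\<^bsub>P 1\<^esub> b \<odot>\<^bsub>P 1\<^esub> p j) = \<zero>\<^bsub>P 0\<^esub>"
      using ab p0 P0.smult_l_null[of p0] by simp
    then show "\<exists>y\<in>carrier (P 2). \<delta> 1 y = a \<odot>\<^bsub>P 1\<^esub> p i \<oplus>\<^bsub>P 1\<^esub> b \<odot>\<^bsub>P 1\<^esub> p j"
      by (rule mod_hom_kernel_image[OF ex1]) (use ij p in simp)
  next
    fix i j u v and a b r s :: "('x, 'k) mpoly"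
    assume ij: "i \<in> I" "j \<in> I" and uv: "u \<in> carrier (P 2)" "v \<in> carrier (P 2)"
      and rel: "a * r * monomial (g i) + b * s * monomial (g j) = 0"
      and \<delta>uv: "\<delta> 1 (a \<odot>\<^bsub>P 2\<^esub> u \<oplus>\<^bsub>P 2\<^esub> b \<odot>\<^bsub>P 2\<^esub> v) = (a * r) \<odot>\<^bsub>P 1\<^esub> p i \<oplus>\<^bsub>P 1\<^esub> (b * s) \<odot>\<^bsub>P 1\<^esub> p j"
    let ?z = "\<lambda>k. \<gamma> (\<delta> 1 u) k - r * \<zeta> i k" and ?z' = "\<lambda>k. \<gamma> (\<delta> 1 v) k - s * \<zeta> j k"
    have "a * \<gamma> (\<delta> 1 u) k + b * \<gamma> (\<delta> 1 v) k = a * r * \<gamma> (p i) k + b * s * \<gamma> (p j) k" for k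
    proof -
      have "a * \<gamma> (\<delta> 1 u) k + b * \<gamma> (\<delta> 1 v) k = \<gamma> (\<delta> 1 (a \<odot>\<^bsub>P 2\<^esub> u \<oplus>\<^bsub>P 2\<^esub> b \<odot>\<^bsub>P 2\<^esub> v)) k"
        using uv by (simp add: mod_homD[OF d1] \<gamma>lin)
      then show ?thesis unfolding \<delta>uv using ij p by (simp add: \<gamma>lin)
    qed
    then have "a * ?z k + b * ?z' k =
        (if k = i then a * r else 0) + (if k = j then b * s else 0) +
        (a * r * monomial (g i) + b * s * monomial (g j)) * f0 k" for k
      by (simp add: \<zeta>_def algebra_simps)
    then have "\<forall>k\<in>I. a * ?z k + b * ?z' k = (if k = i then a * r else 0) + (if k = j then b * s else 0)"
      by (simp add: rel)
    moreover have "monomial_comb I g ?z = 0" "monomial_comb I g ?z' = 0"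
      using uv ij by (simp_all add: monomial_comb_diff monomial_comb_mult \<gamma>\<delta> \<zeta>)
    ultimately show "\<exists>z z'. monomial_comb I g z = 0 \<and> monomial_comb I g z' = 0 \<and>
        (\<forall>k\<in>I. a * z k + b * z' k = (if k = i then a * r else 0) + (if k = j then b * s else 0))"
      by blast
  qed
qed

section \<open>Lower bounds for the projective dimension\<close>

text \<open>
  If \<open>P 2\<close> vanishes, the lift of the syzygy of \<open>g i\<close> and \<open>g j\<close> is zero, that is
  \<open>a 0 + b 0\<close> with the coefficients \<open>a\<close> and \<open>b\<close> of this syzygy. With these,
  \<open>no_syzygy_factor\<close> asks whether some \<open>g k\<close> divides \<open>lcm/a = g i\<close>, and whether \<open>g i\<close> divides
  \<open>lcm/b = g j\<close>.
\<close>
lemma length_one_impossible: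
  fixes g :: "'i \<Rightarrow> 'x \<Rightarrow>\<^sub>0 nat" and M :: "('x, 'k :: field) mpoly set"
    and P :: "nat \<Rightarrow> (('x, 'k) mpoly, 'u) module"
  assumes fin: "finite I" and M: "M = range (monomial_comb I g)"
    and res: "projective_resolution mpoly_ring (quotient_module mpoly_ring M) P \<delta> \<epsilon>"
    and ij: "i \<in> I" "j \<in> I" "i \<noteq> j"
    and antichain: "\<And>k l. k \<in> I \<Longrightarrow> l \<in> I \<Longrightarrow> k \<noteq> l \<Longrightarrow> \<not> g k \<preceq> g l"
  shows "carrier (P 2) \<noteq> {\<zero>\<^bsub>P 2\<^esub>}"
proof
  assume zero: "carrier (P 2) = {\<zero>\<^bsub>P 2\<^esub>}"
  have "projective_module mpoly_ring (P 2)" using res by (simp add: projective_resolution_def)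
  then interpret P2: module mpoly_ring "P 2" by (simp add: projective_module_def)
  define L where "L = exp_lcm (g i) (g j)"
  define a where "a = L - g i"
  define b where "b = L - g j"
  have le: "g i \<preceq> L" "g j \<preceq> L" by (simp_all add: L_def)
  obtain p where p_lift: "syzygy_lift I g P \<delta> p"
    using syzygy_lift_exists[OF fin M res] by blast
  note pair = syzygy_liftD(2)[OF p_lift] and split = syzygy_liftD(3)[OF p_lift]
  have rel: "monomial a * 1 * monomial (g i) + monomial b * (- 1) * monomial (g j) = (0 :: ('x, 'k) mpoly)"
    using monomial_mult_diff[OF le(1), where 'k = 'k] monomial_mult_diff[OF le(2), where 'k = 'k]
    by (simp add: a_def b_def mult.commute)
  obtain y where y: "y \<in> carrier (P 2)"
    "\<delta> 1 y = (monomial a * 1) \<odot>\<^bsub>P 1\<^esub> p i \<oplus>\<^bsub>P 1\<^esub> (monomial b * (- 1)) \<odot>\<^bsub>P 1\<^esub> p j"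
    using pair[OF ij(1,2) rel] by blast
  have \<delta>0: "\<delta> 1 (monomial a \<odot>\<^bsub>P 2\<^esub> \<zero>\<^bsub>P 2\<^esub> \<oplus>\<^bsub>P 2\<^esub> monomial b \<odot>\<^bsub>P 2\<^esub> \<zero>\<^bsub>P 2\<^esub>) =
      (monomial a * 1) \<odot>\<^bsub>P 1\<^esub> p i \<oplus>\<^bsub>P 1\<^esub> (monomial b * (- 1)) \<odot>\<^bsub>P 1\<^esub> p j"
    using y zero by simp
  obtain z z' :: "'i \<Rightarrow> ('x, 'k) mpoly" where z: "monomial_comb I g z = 0"
    and eq: "\<forall>k\<in>I. monomial a * z k + monomial b * z' k =
      (if k = i then monomial a * 1 else 0) + (if k = j then monomial b * (- 1) else 0)"
    using split[OF ij(1,2) P2.M.zero_closed P2.M.zero_closed rel \<delta>0] by blast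
  have eq_i: "monomial a * z i + monomial b * z' i = monomial (L - g i)"
    using bspec[OF eq ij(1)] ij(3) by (simp add: a_def)
  show False
  proof (rule no_syzygy_factor[where g = g and z = z and z' = z' and i = i, OF fin ij(1) le(1) z eq_i])
    fix k assume "k \<in> I - {i}"
    then have "\<not> g k \<preceq> g i" using antichain ij(1) by blast
    then obtain x where "Poly_Mapping.lookup (g k) x > Poly_Mapping.lookup (g i) x" by (auto simp: not_le)
    moreover have "Poly_Mapping.lookup (g i) x \<le> Poly_Mapping.lookup L x" using le(1) by blast
    ultimately have "\<not> Poly_Mapping.lookup (g k + a) x \<le> Poly_Mapping.lookup L x"
      by (simp add: a_def lookup_add lookup_minus)
    then show "\<not> g k + a \<preceq> L" by blast
  next
    have "\<not> g i \<preceq> g j" using antichain ij by blast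
    then obtain x where "Poly_Mapping.lookup (g i) x > Poly_Mapping.lookup (g j) x" by (auto simp: not_le)
    then have "\<not> Poly_Mapping.lookup (g i + b) x \<le> Poly_Mapping.lookup L x"
      by (simp add: b_def L_def lookup_add lookup_minus)
    then show "\<not> g i + b \<preceq> L" by blast
  qed
qed

text \<open>
  The variables \<open>xi\<close> and \<open>xj\<close> witness that \<open>g i\<close> and \<open>g j\<close> each exceed the other two members of
  the triple somewhere, so \<open>c\<close> involves \<open>xi\<close> and \<open>b\<close> involves \<open>xj\<close>. As the exponent of
  \<open>lcm (g i) (g j)\<close> at \<open>xi\<close> is that of \<open>g i\<close>, it is exceeded by \<open>g i + c\<close>, and similarly with
  \<open>xj\<close> for \<open>g j + b\<close>. The remaining generators, among them \<open>g l\<close>, do not divide the least common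
  multiple at all. The monomials \<open>a\<close>, \<open>b\<close> and \<open>c\<close> are pairwise coprime because at every
  variable at most one of the three members of the triple exceeds the other two.
\<close>
lemma length_two_impossible:
  fixes g :: "'i \<Rightarrow> 'x \<Rightarrow>\<^sub>0 nat" and M :: "('x, 'k :: field) mpoly set"
    and P :: "nat \<Rightarrow> (('x, 'k) mpoly, 'u) module"
  assumes fin: "finite I" and M: "M = range (monomial_comb I g)"
    and res: "projective_resolution mpoly_ring (quotient_module mpoly_ring M) P \<delta> \<epsilon>"
    and ijl: "i \<in> I" "j \<in> I" "l \<in> I" "i \<noteq> j"
    and others: "\<And>k. k \<in> I - {i, j} \<Longrightarrow> \<not> g k \<preceq> exp_lcm (g i) (g j)"
    and xi: "Poly_Mapping.lookup (exp_lcm (g j) (g l)) xi < Poly_Mapping.lookup (g i) xi"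
    and xj: "Poly_Mapping.lookup (exp_lcm (g i) (g l)) xj < Poly_Mapping.lookup (g j) xj"
  shows "carrier (P 3) \<noteq> {\<zero>\<^bsub>P 3\<^esub>}"
proof
  note One_nat_def [simp del]
  assume zero: "carrier (P 3) = {\<zero>\<^bsub>P 3\<^esub>}"
  let ?R = "mpoly_ring :: ('x, 'k) mpoly ring"
  let ?m = "monomial :: _ \<Rightarrow> ('x, 'k) mpoly"
  have proj: "projective_module ?R (P i)" for i using res by (simp add: projective_resolution_def)
  then have P: "module ?R (P i)" for i by (simp add: projective_module_def)
  interpret P1: module ?R "P 1" by (rule P)
  interpret P2: module ?R "P 2" by (rule P)
  have d1: "\<delta> 1 \<in> mod_hom ?R (P 2) (P 1)" and d2: "\<delta> 2 \<in> mod_hom ?R (P 3) (P 2)"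
    and ex1: "\<delta> 2 ` carrier (P 3) = a_kernel (P 2) (P 1) (\<delta> 1)"
    using res by (auto simp: projective_resolution_def numeral_2_eq_2 numeral_3_eq_3 One_nat_def)

  define T where "T = exp_lcm (exp_lcm (g i) (g j)) (g l)"
  define L where "L = exp_lcm (g i) (g j)"
  define Ljl where "Ljl = exp_lcm (g j) (g l)"
  define Lil where "Lil = exp_lcm (g i) (g l)"
  define a where "a = T - L"
  define b where "b = T - Lil"
  define c where "c = T - Ljl"
  have le: "g i \<preceq> L" "g j \<preceq> L" "g j \<preceq> Ljl" "g l \<preceq> Ljl" "g i \<preceq> Lil" "g l \<preceq> Lil"
    "L \<preceq> T" "Ljl \<preceq> T" "Lil \<preceq> T"
    by (auto simp: T_def L_def Ljl_def Lil_def le_max_iff_disj)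
  have chain: "?m (T - N) * ?m (N - e) = ?m (T - e)" if "e \<preceq> N" "N \<preceq> T" for e N
  proof -
    have "(T - N) + (N - e) = T - e"
      using that by (intro poly_mapping_eqI) (simp add: lookup_add lookup_minus)
    then show ?thesis by (simp add: monomial_mult)
  qed
  have syz: "?m (N - e) * ?m e + - ?m (N - f) * ?m f = 0" if "e \<preceq> N" "f \<preceq> N" for N e f
    using that by (simp add: monomial_mult_diff mult.commute)

  obtain p where p_lift: "syzygy_lift I g P \<delta> p"
    using syzygy_lift_exists[OF fin M res] by blast
  note p = syzygy_liftD(1)[OF p_lift] and pair = syzygy_liftD(2)[OF p_lift] and split = syzygy_liftD(3)[OF p_lift]
  obtain yij where yij: "yij \<in> carrier (P 2)"
    "\<delta> 1 yij = ?m (L - g i) \<odot>\<^bsub>P 1\<^esub> p i \<oplus>\<^bsub>P 1\<^esub> (- ?m (L - g j)) \<odot>\<^bsub>P 1\<^esub> p j"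
    using pair[OF ijl(1,2) syz[OF le(1,2)]] by blast
  obtain yjl where yjl: "yjl \<in> carrier (P 2)"
    "\<delta> 1 yjl = ?m (Ljl - g j) \<odot>\<^bsub>P 1\<^esub> p j \<oplus>\<^bsub>P 1\<^esub> (- ?m (Ljl - g l)) \<odot>\<^bsub>P 1\<^esub> p l"
    using pair[OF ijl(2,3) syz[OF le(3,4)]] by blast
  obtain yli where yli: "yli \<in> carrier (P 2)"
    "\<delta> 1 yli = ?m (Lil - g l) \<odot>\<^bsub>P 1\<^esub> p l \<oplus>\<^bsub>P 1\<^esub> (- ?m (Lil - g i)) \<odot>\<^bsub>P 1\<^esub> p i"
    using pair[OF ijl(3,1) syz[OF le(6,5)]] by blast

  have scale: "?m (T - N) \<odot>\<^bsub>P 1\<^esub> (?m (N - e) \<odot>\<^bsub>P 1\<^esub> x \<oplus>\<^bsub>P 1\<^esub> (- ?m (N - f)) \<odot>\<^bsub>P 1\<^esub> y) =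
      ?m (T - e) \<odot>\<^bsub>P 1\<^esub> x \<oplus>\<^bsub>P 1\<^esub> (- ?m (T - f)) \<odot>\<^bsub>P 1\<^esub> y"
    if "e \<preceq> N" "f \<preceq> N" "N \<preceq> T" "x \<in> carrier (P 1)" "y \<in> carrier (P 1)" for N e f x y
    using that chain[of e N] chain[of f N] P1.smult_assoc1[of "?m (T - N)" "?m (N - e)" x]
      P1.smult_assoc1[of "?m (T - N)" "- ?m (N - f)" y]
    by (simp add: P1.smult_r_distr)
  \<comment> \<open>The lift of the cyclic relation over the triple. Its image is zero, and \<open>\<delta> 1\<close> is injective
    because \<open>P 3\<close> vanishes.\<close>
  let ?w = "?m a \<odot>\<^bsub>P 2\<^esub> yij \<oplus>\<^bsub>P 2\<^esub> ?m c \<odot>\<^bsub>P 2\<^esub> yjl \<oplus>\<^bsub>P 2\<^esub> ?m b \<odot>\<^bsub>P 2\<^esub> yli"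
  have "\<delta> 1 ?w = \<zero>\<^bsub>P 1\<^esub>"
    using yij yjl yli p ijl
    by (simp add: mod_homD[OF d1] a_def b_def c_def scale le)
      (rule smult_cycle[OF P], simp_all)
  moreover have "?w \<in> carrier (P 2)" using yij yjl yli by simp
  ultimately obtain t where "t \<in> carrier (P 3)" "\<delta> 2 t = ?w"
    using mod_hom_kernel_image[OF ex1] by blast
  then have w: "?w = \<zero>\<^bsub>P 2\<^esub>" using zero mod_hom_zero[OF P P d2] by simp

  have cop: "Poly_Mapping.lookup a x = 0 \<or> Poly_Mapping.lookup c x = 0"
    "Poly_Mapping.lookup a x = 0 \<or> Poly_Mapping.lookup b x = 0" for x
    by (auto simp: a_def b_def c_def T_def L_def Ljl_def Lil_def lookup_minus max_def)
  obtain v u where uv: "v \<in> carrier (P 2)" "u \<in> carrier (P 2)"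
    and yuv: "yij = ?m c \<odot>\<^bsub>P 2\<^esub> v \<oplus>\<^bsub>P 2\<^esub> ?m b \<odot>\<^bsub>P 2\<^esub> u"
    using projective_module_relation[OF proj[of 2] _ _ _ yij(1) yjl(1) yli(1) w]
      coprime_relation[of a _ c _ b, OF _ cop]
    by auto
  then have yuv': "yij = ?m b \<odot>\<^bsub>P 2\<^esub> u \<oplus>\<^bsub>P 2\<^esub> ?m c \<odot>\<^bsub>P 2\<^esub> v"
    by (simp add: P2.M.a_comm)
  have bc: "b \<preceq> L - g i" "c \<preceq> L - g j"
    by (auto simp: b_def c_def T_def L_def Ljl_def Lil_def lookup_minus max_def)
  have fac: "?m b * ?m (L - g i - b) = ?m (L - g i)" "?m c * (- ?m (L - g j - c)) = - ?m (L - g j)"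
    using bc by (simp_all add: monomial_mult_diff)
  obtain z z' :: "'i \<Rightarrow> ('x, 'k) mpoly" where z: "monomial_comb I g z = 0"
    and eq: "\<forall>k\<in>I. ?m b * z k + ?m c * z' k =
      (if k = i then ?m (L - g i) else 0) + (if k = j then - ?m (L - g j) else 0)"
    using split[OF ijl(1,2) uv(2,1), of "?m b" "?m (L - g i - b)" "?m c" "- ?m (L - g j - c)",
        unfolded fac, OF syz[OF le(1,2)] yij(2)[unfolded yuv']] by blast
  have eq_i: "?m b * z i + ?m c * z' i = ?m (L - g i)"
    using bspec[OF eq ijl(1)] ijl(4) by simp
  show False
  proof (rule no_syzygy_factor[where g = g and z = z and z' = z' and i = i, OF fin ijl(1) le(1) z eq_i])
    fix k assume k: "k \<in> I - {i}"
    show "\<not> g k + b \<preceq> L"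
    proof (cases "k = j")
      case True
      have "Poly_Mapping.lookup (g i) xj < Poly_Mapping.lookup (g j) xj" "Poly_Mapping.lookup (g l) xj < Poly_Mapping.lookup (g j) xj"
        using xj by simp_all
      then have "\<not> Poly_Mapping.lookup (g k + b) xj \<le> Poly_Mapping.lookup L xj"
        by (auto simp: True b_def T_def L_def Lil_def lookup_add lookup_minus max_def)
      then show ?thesis by blast
    next
      case False
      then obtain x where "\<not> Poly_Mapping.lookup (g k) x \<le> Poly_Mapping.lookup L x"
        using others k unfolding L_def by blast
      then have "\<not> Poly_Mapping.lookup (g k + b) x \<le> Poly_Mapping.lookup L x"
        by (simp add: lookup_add)
      then show ?thesis by blast
    qed
  next
    have "Poly_Mapping.lookup (g j) xi < Poly_Mapping.lookup (g i) xi" "Poly_Mapping.lookup (g l) xi < Poly_Mapping.lookup (g i) xi"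
      using xi by simp_all
    then have "\<not> Poly_Mapping.lookup (g i + c) xi \<le> Poly_Mapping.lookup L xi"
      by (auto simp: c_def T_def L_def Ljl_def lookup_add lookup_minus max_def)
    then show "\<not> g i + c \<preceq> L" by blast
  qed
qed

section \<open>A resolution of length two\<close>

text \<open>
  By \<open>syzygy_term\<close> every term of \<open>f i * monomial (g i)\<close> with \<open>i \<noteq> l\<close> is a multiple of \<open>g l\<close>
  or of \<open>lcm (g i) (g j)\<close> for another \<open>j \<noteq> l\<close>, hence of \<open>g l\<close> in both cases. So the \<open>f i\<close> are multiples
  of the coefficients of the syzygies of \<open>g i\<close> and \<open>g l\<close>. The coefficient \<open>f l\<close> is then determined,
  since a monomial is not a zero divisor.
\<close>
lemma syzygies_at_common_divisor:
  fixes g :: "'i \<Rightarrow> 'x \<Rightarrow>\<^sub>0 nat" and f :: "'i \<Rightarrow> ('x, 'k :: field) mpoly"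
  assumes fin: "finite I" and l: "l \<in> I"
    and dvd: "\<And>i j. i \<in> I - {l} \<Longrightarrow> j \<in> I - {l} \<Longrightarrow> i \<noteq> j \<Longrightarrow> g l \<preceq> exp_lcm (g i) (g j)"
    and syz: "monomial_comb I g f = 0"
  shows "\<exists>c. (\<forall>i\<in>I - {l}. f i = c i * monomial (exp_lcm (g i) (g l) - g i)) \<and>
    f l = - (\<Sum>i\<in>I - {l}. c i * monomial (exp_lcm (g i) (g l) - g l))"
proof -
  define h where "h i = exp_lcm (g i) (g l)" for i
  have hle: "g i \<preceq> h i" "g l \<preceq> h i" for i by (simp_all add: h_def)
  have swap: "monomial (h i - g i) * monomial (g i) = monomial (h i - g l) * (monomial (g l) :: ('x, 'k) mpoly)" for i
    using monomial_mult_diff[OF hle(1), where 'k = 'k, of i]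
      monomial_mult_diff[OF hle(2), where 'k = 'k, of i]
    by (simp add: mult.commute)
  have "monomial (h i - g i) dvd f i" if i: "i \<in> I - {l}" for i
    unfolding monomial_dvd_iff
  proof
    fix t assume t: "t \<in> Poly_Mapping.keys (f i)"
    obtain j where j: "j \<in> I - {i}" "g j \<preceq> g i + t"
      using syzygy_term[OF fin _ syz[unfolded monomial_comb_def] t] i by blast
    have "g l \<preceq> g i + t"
    proof (cases "j = l")
      case False
      then have "g l \<preceq> exp_lcm (g i) (g j)" using dvd[of i j] i j by blast
      moreover have "exp_lcm (g i) (g j) \<preceq> g i + t" using j(2) by (simp add: lookup_add)
      ultimately show ?thesis using order_trans by blast
    qed (use j in simp)
    then show "h i - g i \<preceq> t"
      by (auto simp: h_def lookup_add lookup_minus le_diff_conv add.commute)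
  qed
  then have "\<forall>i\<in>I - {l}. \<exists>q. f i = q * monomial (h i - g i)" by (metis dvd_def mult.commute)
  then obtain c where c: "\<And>i. i \<in> I - {l} \<Longrightarrow> f i = c i * monomial (h i - g i)" by metis
  have "f i * monomial (g i) = monomial (g l) * (c i * monomial (h i - g l))" if "i \<in> I - {l}" for i
    using swap[of i] by (simp add: c[OF that] mult_ac)
  then have "(\<Sum>i\<in>I - {l}. f i * monomial (g i)) = monomial (g l) * (\<Sum>i\<in>I - {l}. c i * monomial (h i - g l))"
    by (simp add: sum_distrib_left)
  then have "monomial (g l) * (f l + (\<Sum>i\<in>I - {l}. c i * monomial (h i - g l))) = 0"
    using syz l fin by (simp add: monomial_comb_def sum.remove distrib_left mult.commute)
  then have "f l = - (\<Sum>i\<in>I - {l}. c i * monomial (h i - g l))"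
    by (simp add: monomial_mult_eq_0_iff eq_neg_iff_add_eq_0)
  with c show ?thesis unfolding h_def by blast
qed

lemma common_divisor_syzygy:
  fixes g :: "'i \<Rightarrow> 'x \<Rightarrow>\<^sub>0 nat" and f :: "'i \<Rightarrow> ('x, 'k :: field) mpoly"
  assumes fin: "finite I" and l: "l \<in> I"
    and f: "\<And>i. i \<in> I - {l} \<Longrightarrow> f i = c i * monomial (exp_lcm (g i) (g l) - g i)"
    "f l = - (\<Sum>i\<in>I - {l}. c i * monomial (exp_lcm (g i) (g l) - g l))"
  shows "monomial_comb I g f = 0"
proof -
  define h where "h i = exp_lcm (g i) (g l)" for i
  have hle: "g i \<preceq> h i" "g l \<preceq> h i" for i by (simp_all add: h_def)
  have swap: "monomial (h i - g i) * monomial (g i) = monomial (h i - g l) * (monomial (g l) :: ('x, 'k) mpoly)" for i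
    using monomial_mult_diff[OF hle(1), where 'k = 'k, of i]
      monomial_mult_diff[OF hle(2), where 'k = 'k, of i]
    by (simp add: mult.commute)
  have "f i * monomial (g i) = c i * monomial (h i - g l) * monomial (g l)" if "i \<in> I - {l}" for i
    using swap[of i] by (simp add: f(1)[OF that, folded h_def] mult.assoc)
  then have "(\<Sum>i\<in>I - {l}. f i * monomial (g i)) = - f l * monomial (g l)"
    by (simp add: f(2) h_def sum_distrib_right)
  then show ?thesis using l fin by (simp add: monomial_comb_def sum.remove)
qed

text \<open>
  The terms are free on \<open>1\<close>, \<open>q + 1\<close> and \<open>q\<close> elements. The differential \<open>\<delta>1\<close> sends the \<open>i\<close>-th basis
  element to the syzygy of \<open>g i\<close> and \<open>g 0\<close>. It is injective, since its \<open>i\<close>-th coordinate for \<open>i \<ge> 1\<close>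
  is multiplication by a monomial, and it is onto the syzygies by \<open>syzygies_at_common_divisor\<close>.
\<close>
lemma length_two_resolution:
  fixes g :: "nat \<Rightarrow> 'x \<Rightarrow>\<^sub>0 nat" and M :: "('x, 'k :: field) mpoly set"
  assumes M: "M = range (monomial_comb {0..q} g)"
    and dvd: "\<And>i j. i \<in> {1..q} \<Longrightarrow> j \<in> {1..q} \<Longrightarrow> i \<noteq> j \<Longrightarrow> g 0 \<preceq> exp_lcm (g i) (g j)"
  shows "\<exists>(P :: nat \<Rightarrow> (('x, 'k) mpoly, nat \<times> 'b \<Rightarrow> ('x, 'k) mpoly) module) \<delta> \<epsilon>.
    projective_resolution mpoly_ring (quotient_module mpoly_ring M) P \<delta> \<epsilon> \<and>
    (\<forall>i>2. carrier (P i) = {\<zero>\<^bsub>P i\<^esub>})"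
proof -
  note One_nat_def [simp del]
  let ?R = "mpoly_ring :: ('x, 'k) mpoly ring"
  let ?m = "monomial :: _ \<Rightarrow> ('x, 'k) mpoly"
  let ?N = "quotient_module ?R M"
  have R: "cring ?R" by (rule cring_from_type_algebra)
  have IM: "ideal M ?R" unfolding M by (rule ideal_range_monomial_comb)
  note pi = quotient_map[OF R IM, simplified]
  define h where "h i = exp_lcm (g i) (g 0)" for i
  \<comment> \<open>A fixed second component places the index sets inside the type over which resolutions are formed.\<close>
  define u :: 'b where "u = undefined"
  define J :: "nat \<Rightarrow> (nat \<times> 'b) set" where
    "J i = (if i = 0 then {(0, u)} else if i = 1 then {0..q} \<times> {u} else if i = 2 then {1..q} \<times> {u} else {})" for i
  define P where "P i = free_module ?R (J i)" for i
  define \<epsilon> where "\<epsilon> f = M +>\<^bsub>?R\<^esub> f (0, u)" for f :: "nat \<times> 'b \<Rightarrow> ('x, 'k) mpoly"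
  define \<delta>0 :: "(nat \<times> 'b \<Rightarrow> ('x, 'k) mpoly) \<Rightarrow> nat \<times> 'b \<Rightarrow> ('x, 'k) mpoly" where
    "\<delta>0 f x = (if x = (0, u) then monomial_comb {0..q} g (\<lambda>i. f (i, u)) else 0)" for f x
  define \<delta>1 :: "(nat \<times> 'b \<Rightarrow> ('x, 'k) mpoly) \<Rightarrow> nat \<times> 'b \<Rightarrow> ('x, 'k) mpoly" where
    "\<delta>1 f x = (if x = (0, u) then - (\<Sum>i\<in>{1..q}. f (i, u) * ?m (h i - g 0)) else f x * ?m (h (fst x) - g (fst x)))" for f x
  define \<delta> where "\<delta> i = (if i = 0 then \<delta>0 else if i = 1 then \<delta>1 else (\<lambda>f x. 0))" for i :: nat
  have finJ: "finite (J i)" for i by (simp add: J_def)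
  have Pc: "carrier (P i) = {f. \<forall>x. x \<notin> J i \<longrightarrow> f x = 0}" for i
    unfolding P_def by (rule free_module_mpoly_simps[OF finJ])
  have Pops: "f \<oplus>\<^bsub>P i\<^esub> f' = (\<lambda>x. f x + f' x)" "r \<odot>\<^bsub>P i\<^esub> f = (\<lambda>x. r * f x)" "\<zero>\<^bsub>P i\<^esub> = (\<lambda>x. 0)" for f f' r i
    by (simp_all add: P_def)
  have J012: "J 0 = {(0, u)}" "J 1 = {0..q} \<times> {u}" "J 2 = {1..q} \<times> {u}" by (simp_all add: J_def)
  have Jbig: "J i = {}" if "i > 2" for i using that by (simp add: J_def)
  have I0: "{0..q} - {0} = {1..q}" by auto
  have ker: "a_kernel A B k = {x \<in> carrier A. k x = \<zero>\<^bsub>B\<^esub>}" for A :: "('y, 'c) module" and B :: "('z, 'd) module" and k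
    by (simp add: a_kernel_def kernel_def)

  have eps: "\<epsilon> \<in> mod_hom ?R (P 0) ?N"
    using mod_homD[OF pi(1)] by (auto simp: mod_hom_def Pops \<epsilon>_def)
  have eps_surj: "\<epsilon> ` carrier (P 0) = carrier ?N"
  proof (intro equalityI subsetI)
    fix y assume "y \<in> carrier ?N"
    then obtain r where "y = M +>\<^bsub>?R\<^esub> r" using pi(2) by (metis imageE)
    then have "y = \<epsilon> (\<lambda>x. if x = (0, u) then r else 0)" by (simp add: \<epsilon>_def)
    then show "y \<in> \<epsilon> ` carrier (P 0)" by (auto simp: Pc J012)
  qed (use mod_homD(1)[OF eps] in auto)

  have hom0: "\<delta>0 \<in> mod_hom ?R (P 1) (P 0)"
    by (auto simp: mod_hom_def Pc Pops J012 \<delta>0_def fun_eq_iff monomial_comb_add monomial_comb_mult)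
  have hom1: "\<delta>1 \<in> mod_hom ?R (P 2) (P 1)"
    by (auto simp: mod_hom_def Pc Pops J012 \<delta>1_def fun_eq_iff distrib_right sum.distrib sum_distrib_left mult.assoc)
  have hom: "\<delta> i \<in> mod_hom ?R (P (Suc i)) (P i)" for i
  proof -
    consider "i = 0" | "i = 1" | "i \<ge> 2" by linarith
    then show ?thesis
    proof cases
      case 3
      then show ?thesis by (auto simp: \<delta>_def mod_hom_def Pc Pops)
    qed (use hom0 hom1 in \<open>simp_all add: \<delta>_def numeral_2_eq_2 One_nat_def\<close>)
  qed

  have ex0: "\<delta>0 ` carrier (P 1) = a_kernel (P 0) ?N \<epsilon>"
  proof (intro equalityI subsetI)
    fix f assume "f \<in> \<delta>0 ` carrier (P 1)"
    then obtain f' where f': "f' \<in> carrier (P 1)" "f = \<delta>0 f'" by blast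
    then have "f (0, u) \<in> M" by (simp add: \<delta>0_def M)
    then have "\<epsilon> f = \<zero>\<^bsub>?N\<^esub>" using pi(3) by (simp add: \<epsilon>_def)
    then show "f \<in> a_kernel (P 0) ?N \<epsilon>" using f' mod_homD(1)[OF hom0] by (simp add: ker)
  next
    fix f assume "f \<in> a_kernel (P 0) ?N \<epsilon>"
    then have f: "f \<in> carrier (P 0)" "f (0, u) \<in> M" using pi(3) by (auto simp: ker \<epsilon>_def)
    then obtain c where c: "f (0, u) = monomial_comb {0..q} g c" unfolding M by blast
    let ?c = "\<lambda>x. if x \<in> J 1 then c (fst x) else 0"
    have "f = \<delta>0 ?c"
      using f(1) c by (auto simp: fun_eq_iff \<delta>0_def Pc J012 monomial_comb_def)
    then show "f \<in> \<delta>0 ` carrier (P 1)" by (rule image_eqI[of _ _ ?c]) (simp add: Pc)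
  qed

  have ex1: "\<delta>1 ` carrier (P 2) = a_kernel (P 1) (P 0) \<delta>0"
  proof (intro equalityI subsetI)
    fix f assume "f \<in> \<delta>1 ` carrier (P 2)"
    then obtain c where c: "c \<in> carrier (P 2)" "f = \<delta>1 c" by blast
    have "monomial_comb {0..q} g (\<lambda>i. f (i, u)) = 0"
      by (rule common_divisor_syzygy[where l = 0 and c = "\<lambda>i. c (i, u)"])
        (auto simp: c(2) \<delta>1_def h_def I0)
    then have "\<delta>0 f = \<zero>\<^bsub>P 0\<^esub>" by (simp add: \<delta>0_def Pops fun_eq_iff)
    then show "f \<in> a_kernel (P 1) (P 0) \<delta>0" using c mod_homD(1)[OF hom1] by (simp add: ker)
  next
    fix f assume "f \<in> a_kernel (P 1) (P 0) \<delta>0"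
    then have f: "f \<in> carrier (P 1)" "\<delta>0 f (0, u) = 0" by (auto simp: ker Pops)
    have "monomial_comb {0..q} g (\<lambda>i. f (i, u)) = 0" using f(2) by (simp add: \<delta>0_def)
    from syzygies_at_common_divisor[OF _ _ _ this, of 0, unfolded I0]
    obtain c where c: "\<forall>i\<in>{1..q}. f (i, u) = c i * ?m (h i - g i)"
      "f (0, u) = - (\<Sum>i\<in>{1..q}. c i * ?m (h i - g 0))"
      using dvd unfolding h_def by auto
    let ?c = "\<lambda>x. if x \<in> J 2 then c (fst x) else 0"
    have "f x = \<delta>1 ?c x" for x
    proof (cases "x \<in> J 1")
      case True
      then obtain i where "x = (i, u)" "i \<le> q" by (auto simp: J012)
      then show ?thesis using c by (cases "i = 0") (simp_all add: \<delta>1_def J012)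
    next
      case False
      then show ?thesis using f(1) by (cases x) (auto simp: \<delta>1_def J012 Pc)
    qed
    then have "f = \<delta>1 ?c" by (rule ext)
    then show "f \<in> \<delta>1 ` carrier (P 2)" by (rule image_eqI[of _ _ ?c]) (simp add: Pc)
  qed

  have inj1: "f = (\<lambda>x. 0)" if f: "f \<in> carrier (P 2)" "\<delta>1 f = (\<lambda>x. 0)" for f
  proof
    fix x
    show "f x = 0"
    proof (cases "x \<in> J 2")
      case True
      then have "\<delta>1 f x = ?m (h (fst x) - g (fst x)) * f x" by (auto simp: \<delta>1_def J012 mult.commute)
      then show ?thesis using f(2) monomial_mult_eq_0_iff by metis
    qed (use f(1) in \<open>cases x, simp add: Pc\<close>)
  qed
  have ex2: "\<delta> (Suc i) ` carrier (P (Suc (Suc i))) = a_kernel (P (Suc i)) (P i) (\<delta> i)" for i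
  proof -
    consider "i = 0" | "i = 1" | "i \<ge> 2" by linarith
    then show ?thesis
    proof cases
      case 1
      then show ?thesis using ex1 by (simp add: \<delta>_def numeral_2_eq_2 One_nat_def)
    next
      case 2
      then have "a_kernel (P (Suc i)) (P i) (\<delta> i) = {\<lambda>x. 0}"
        using inj1 by (auto simp: ker Pops \<delta>_def Pc \<delta>1_def fun_eq_iff numeral_2_eq_2 One_nat_def)
      moreover have "\<delta> (Suc i) ` carrier (P (Suc (Suc i))) = {\<lambda>x. 0}"
        using 2 by (auto simp: \<delta>_def Pc)
      ultimately show ?thesis by simp
    next
      case 3
      then show ?thesis by (auto simp: \<delta>_def ker Pops Pc Jbig fun_eq_iff)
    qed
  qed
  have "projective_module ?R (P i)" for i
    unfolding P_def by (rule projective_free_module[OF R])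
  then have "projective_resolution ?R ?N P \<delta> \<epsilon>"
    unfolding projective_resolution_def
    using eps eps_surj hom ex0 ex2 by (simp add: \<delta>_def)
  moreover have "carrier (P i) = {\<zero>\<^bsub>P i\<^esub>}" if "i > 2" for i
    using that by (auto simp: Pc Pops Jbig)
  ultimately show ?thesis by blast
qed

section \<open>Semidominant ideals\<close>

text \<open>
  A generator that is a multiple of another one can be dropped.
\<close>
lemma minimal_generators_antichain:
  fixes g :: "'i \<Rightarrow> 'x :: finite \<Rightarrow>\<^sub>0 nat" and M :: "('x, 'k :: field) mpoly set"
  assumes inj: "inj_on g I" and min: "minimal_generating_set M (monomial ` g ` I)"
    and ij: "i \<in> I" "j \<in> I" "i \<noteq> j"
  shows "\<not> g i \<preceq> g j"
proof
  assume le: "g i \<preceq> g j"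
  let ?R = "mpoly_ring :: ('x, 'k) mpoly ring"
  interpret ring ?R by (rule ring_from_type_algebra)
  let ?G = "monomial ` g ` I :: ('x, 'k) mpoly set" and ?H = "monomial ` g ` (I - {j}) :: ('x, 'k) mpoly set"
  have "monomial (g j) \<notin> ?H" using inj ij by (auto simp: monomial_eq_iff inj_on_def)
  then have "?H \<subset> ?G" using ij by auto
  have IH: "ideal (Idl\<^bsub>?R\<^esub> ?H) ?R" by (rule genideal_ideal) simp
  have H: "?H \<subseteq> Idl\<^bsub>?R\<^esub> ?H" by (rule genideal_self) simp
  then have "monomial (g i) \<in> Idl\<^bsub>?R\<^esub> ?H" using ij by auto
  then have "monomial (g j) \<in> Idl\<^bsub>?R\<^esub> ?H"
    using ideal.I_r_closed[OF IH, of "monomial (g i)" "monomial (g j - g i)"] monomial_mult_diff[OF le, where 'k = 'k]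
    by simp
  then have "?G \<subseteq> Idl\<^bsub>?R\<^esub> ?H" using H by auto
  then have "Idl\<^bsub>?R\<^esub> ?G \<subseteq> Idl\<^bsub>?R\<^esub> ?H" by (rule genideal_minimal[OF IH])
  moreover have "Idl\<^bsub>?R\<^esub> ?H \<subseteq> Idl\<^bsub>?R\<^esub> ?G"
    using \<open>?H \<subset> ?G\<close> genideal_self[of ?G] by (intro genideal_minimal genideal_ideal) auto
  ultimately have "Idl\<^bsub>?R\<^esub> ?H = Idl\<^bsub>?R\<^esub> ?G" by blast
  then show False using min \<open>?H \<subset> ?G\<close> unfolding minimal_generating_set_def by metis
qed

lemma Var_power: "(Var x :: ('x, 'k :: field) mpoly) ^ k = monomial (Poly_Mapping.single x k)"
  by (induction k) (simp_all add: Var_def monomial_mult single_add[symmetric], simp add: monomial_def)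

lemma Var_power_dvd_monomial_iff:
  "(Var x :: ('x, 'k :: field) mpoly) ^ k dvd monomial a \<longleftrightarrow> k \<le> Poly_Mapping.lookup a x"
  by (auto simp: Var_power monomial_dvd_monomial_iff lookup_single when_def)

text \<open>
  The exponent \<open>k\<close> of the power of \<open>x\<close> that witnesses dominance separates the exponents at \<open>x\<close>.
\<close>
lemma dominant_monomial_variable:
  fixes g :: "'i \<Rightarrow> 'x \<Rightarrow>\<^sub>0 nat"
  assumes "dominant (monomial ` g ` I :: ('x, 'k :: field) mpoly set) (monomial (g i))"
    and inj: "inj_on g I" and i: "i \<in> I"
  shows "\<exists>x. \<forall>j\<in>I - {i}. Poly_Mapping.lookup (g j) x < Poly_Mapping.lookup (g i) x"
proof -
  obtain x k where x: "(Var x :: ('x, 'k) mpoly) ^ k dvd monomial (g i)"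
    and others: "\<forall>m'\<in>monomial ` g ` I - {monomial (g i)}. \<not> (Var x :: ('x, 'k) mpoly) ^ k dvd m'"
    using assms(1) unfolding dominant_def by blast
  have "Poly_Mapping.lookup (g j) x < k" if "j \<in> I - {i}" for j
  proof -
    have "(monomial (g j) :: ('x, 'k) mpoly) \<in> monomial ` g ` I - {monomial (g i)}"
      using that inj i by (auto simp: monomial_eq_iff inj_on_def)
    then have "\<not> (Var x :: ('x, 'k) mpoly) ^ k dvd monomial (g j)" using others by blast
    then show ?thesis by (simp add: Var_power_dvd_monomial_iff)
  qed
  moreover have "k \<le> Poly_Mapping.lookup (g i) x" using x by (simp add: Var_power_dvd_monomial_iff)
  ultimately show ?thesis by (meson less_le_trans)
qed

theorem corollary5p12:
  fixes M :: "('x :: finite, 'k :: field) mpoly set"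
    and m :: "nat \<Rightarrow> ('x \<Rightarrow>\<^sub>0 nat)" and n :: "'x \<Rightarrow>\<^sub>0 nat" and q :: nat
  defines "G \<equiv> insert (monomial n) ((\<lambda>i. monomial (m i)) ` {1..q}) :: ('x, 'k) mpoly set"
  assumes "q \<ge> 1"
    and "inj_on m {1..q}"
    and "semidominant_ideal M"
    and "minimal_generating_set M G"
    and "\<forall>i\<in>{1..q}. dominant G (monomial (m i))"
    and "\<not> dominant G (monomial n)"
  shows "proj_dim mpoly_ring (quotient_module mpoly_ring M) = 2 \<longleftrightarrow>
    (\<forall>i\<in>{1..q}. \<forall>j\<in>{1..q}. i \<noteq> j \<longrightarrow>
      (monomial n :: ('x, 'k) mpoly) dvd monomial (exp_lcm (m i) (m j)))"
proof -
  let ?R = "mpoly_ring :: ('x, 'k) mpoly ring"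
  let ?I = "{0..q}"
  define g where "g i = (if i = 0 then n else m i)" for i
  have I: "?I = insert 0 {1..q}" by auto
  have fin: "finite ?I" by simp
  have G: "G = monomial ` g ` ?I" unfolding G_def I by (auto simp: g_def image_image)
  have nm: "n \<noteq> m i" if "i \<in> {1..q}" for i using assms(6,7) that by metis
  have inj: "inj_on g ?I"
  proof (rule inj_onI)
    fix i j assume ij: "i \<in> ?I" "j \<in> ?I" "g i = g j"
    show "i = j"
    proof (cases "i = 0 \<or> j = 0")
      case True
      then show ?thesis using ij nm[of i] nm[of j] by (auto simp: g_def split: if_splits)
    next
      case False
      then show ?thesis using ij inj_onD[OF assms(3), of i j] by (simp add: g_def)
    qed
  qed
  have "M = Idl\<^bsub>?R\<^esub> G" using assms(5) by (simp add: minimal_generating_set_def)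
  then have M: "M = range (monomial_comb ?I g)" unfolding G using genideal_monomials[OF fin] by simp
  have antichain: "\<not> g i \<preceq> g j" if "i \<in> ?I" "j \<in> ?I" "i \<noteq> j" for i j
    using minimal_generators_antichain[OF inj _ that] assms(5) unfolding G by blast
  have dom: "\<exists>x. \<forall>j\<in>?I - {i}. Poly_Mapping.lookup (g j) x < Poly_Mapping.lookup (g i) x"
    if "i \<in> {1..q}" for i
  proof (rule dominant_monomial_variable[OF _ inj, where 'k = 'k])
    show "dominant (monomial ` g ` ?I :: ('x, 'k) mpoly set) (monomial (g i))"
      using assms(6) that unfolding G by (simp add: g_def)
  qed (use that in simp)
  let ?N = "quotient_module ?R M"
  let ?D = "{d. \<exists>(P :: nat \<Rightarrow> (('x, 'k) mpoly, nat \<times> ('x, 'k) mpoly set \<Rightarrow> ('x, 'k) mpoly) module) \<delta> \<epsilon>.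
    projective_resolution ?R ?N P \<delta> \<epsilon> \<and> (\<forall>i>d. carrier (P i) = {\<zero>\<^bsub>P i\<^esub>})}"
  have "2 \<le> d" if d: "d \<in> ?D" for d
  proof (rule ccontr)
    assume "\<not> 2 \<le> d"
    obtain P :: "nat \<Rightarrow> (('x, 'k) mpoly, nat \<times> ('x, 'k) mpoly set \<Rightarrow> ('x, 'k) mpoly) module" and \<delta> \<epsilon>
      where P: "projective_resolution ?R ?N P \<delta> \<epsilon>" "\<forall>i>d. carrier (P i) = {\<zero>\<^bsub>P i\<^esub>}"
      using d by blast
    have "carrier (P 2) \<noteq> {\<zero>\<^bsub>P 2\<^esub>}"
      by (rule length_one_impossible[OF fin M P(1), of 0 1]) (use assms(2) antichain in auto)
    then show False using P(2) \<open>\<not> 2 \<le> d\<close> by simp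
  qed
  then have pd: "proj_dim ?R ?N = 2 \<longleftrightarrow> 2 \<in> ?D"
    using proj_dim_eq_enat_iff[of ?R ?N 2] by (simp add: numeral_eq_enat)
  have "2 \<in> ?D \<longleftrightarrow> (\<forall>i\<in>{1..q}. \<forall>j\<in>{1..q}. i \<noteq> j \<longrightarrow> n \<preceq> exp_lcm (m i) (m j))"
  proof (intro iffI ballI impI)
    assume "\<forall>i\<in>{1..q}. \<forall>j\<in>{1..q}. i \<noteq> j \<longrightarrow> n \<preceq> exp_lcm (m i) (m j)"
    then show "2 \<in> ?D" using length_two_resolution[OF M] by (simp add: g_def)
  next
    fix i j assume "2 \<in> ?D" and ij: "i \<in> {1..q}" "j \<in> {1..q}" "i \<noteq> j"
    show "n \<preceq> exp_lcm (m i) (m j)"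
    proof (rule ccontr)
      assume n: "\<not> n \<preceq> exp_lcm (m i) (m j)"
      obtain P :: "nat \<Rightarrow> (('x, 'k) mpoly, nat \<times> ('x, 'k) mpoly set \<Rightarrow> ('x, 'k) mpoly) module" and \<delta> \<epsilon>
        where P: "projective_resolution ?R ?N P \<delta> \<epsilon>" "\<forall>i>2. carrier (P i) = {\<zero>\<^bsub>P i\<^esub>}"
        using \<open>2 \<in> ?D\<close> by blast
      obtain xi where xi: "\<forall>k\<in>?I - {i}. Poly_Mapping.lookup (g k) xi < Poly_Mapping.lookup (g i) xi"
        using dom[OF ij(1)] by blast
      obtain xj where xj: "\<forall>k\<in>?I - {j}. Poly_Mapping.lookup (g k) xj < Poly_Mapping.lookup (g j) xj"
        using dom[OF ij(2)] by blast
      have "carrier (P 3) \<noteq> {\<zero>\<^bsub>P 3\<^esub>}"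
      proof (rule length_two_impossible[OF fin M P(1), of i j 0])
        fix k assume k: "k \<in> ?I - {i, j}"
        show "\<not> g k \<preceq> exp_lcm (g i) (g j)"
        proof (cases "k = 0")
          case True
          then show ?thesis using n ij by (simp add: g_def)
        next
          case False
          then obtain x where x: "\<forall>l\<in>?I - {k}. Poly_Mapping.lookup (g l) x < Poly_Mapping.lookup (g k) x"
            using dom[of k] k by auto
          have "i \<in> ?I - {k}" "j \<in> ?I - {k}" using ij k by auto
          from x[rule_format, OF this(1)] x[rule_format, OF this(2)]
          have "\<not> Poly_Mapping.lookup (g k) x \<le> Poly_Mapping.lookup (exp_lcm (g i) (g j)) x" by simp
          then show ?thesis by blast
        qed
      qed (use ij xi xj in auto)
      then show False using P(2) by simp
    qed
  qed
  then show ?thesis unfolding pd monomial_dvd_monomial_iff .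
qed

end
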